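(* Let $\xi$ be a model and $h\ge0$. Then $\sup_{\eta\in\mathcal{K}_{h,\xi}}D(\eta)$ is attained, i.e. $\sup_{\mathcal{K}_{h,\xi}}D=\max_{\mathcal{K}_{h,\xi}}D$, and the maximizer is unique.
   Context: A model is $\xi(t)=\sum_{p\ge2}\beta_p^2t^p$, real $\beta_p$ not all zero, with $\xi(1+\epsilon)<\infty$ for some $\epsilon>0$. $\mathcal{K}_{h,\xi}$ is the set of convex $\eta\in C([0,1])$ with $\eta\ge\xi$ on $[0,1]$, $\eta(1)=\xi(1)$ and right derivative $\eta'(0)=\xi'(0)-h^2$. $\eta''$ is the distributional second derivative (a nonnegative measure on $(0,1)$), $\eta''_{ac}$ the density of its absolutely continuous part, and $D(\eta)=2\int_0^1\sqrt{\eta''_{ac}(x)}dx$. *)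

theory Defs
  imports "HOL-Analysis.Analysis"
begin

definition xi :: "(nat \<Rightarrow> real) \<Rightarrow> real \<Rightarrow> real" where
  "xi \<beta> t = (\<Sum>p. (if 2 \<le> p then (\<beta> p)\<^sup>2 * t ^ p else 0))"

definition is_model :: "(nat \<Rightarrow> real) \<Rightarrow> bool" where
  "is_model \<beta> \<longleftrightarrow> (\<exists>p\<ge>2. \<beta> p \<noteq> 0) \<and>
     (\<exists>\<epsilon>>0. summable (\<lambda>p. if 2 \<le> p then (\<beta> p)\<^sup>2 * (1 + \<epsilon>) ^ p else 0))"

definition rderiv :: "(real \<Rightarrow> real) \<Rightarrow> real \<Rightarrow> real" where
  "rderiv \<eta> x = (THE d. (\<eta> has_real_derivative d) (at_right x))"

definition K_set :: "real \<Rightarrow> (nat \<Rightarrow> real) \<Rightarrow> (real \<Rightarrow> real) set" where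
  "K_set h \<beta> = {\<eta>. continuous_on {0..1} \<eta> \<and> convex_on {0..1} \<eta> \<and>
      (\<forall>t\<in>{0..1}. xi \<beta> t \<le> \<eta> t) \<and> \<eta> 1 = xi \<beta> 1 \<and>
      (\<eta> has_real_derivative (deriv (xi \<beta>) 0 - h\<^sup>2)) (at_right 0)}"

text \<open>f is a density of the absolutely continuous part of eta'' on (0,1), where eta''
  is the Lebesgue-Stieltjes measure of the right derivative of eta on (0,1):
  eta'' = f dx + nu with nu singular w.r.t. Lebesgue measure.\<close>
definition ac_density :: "(real \<Rightarrow> real) \<Rightarrow> (real \<Rightarrow> real) \<Rightarrow> bool" where
  "ac_density \<eta> f \<longleftrightarrow> f \<in> borel_measurable borel \<and> (\<forall>x. 0 \<le> f x) \<and>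
     (\<exists>M \<nu> N. sets M = sets borel \<and> sets \<nu> = sets borel \<and>
        (\<forall>a b. 0 < a \<longrightarrow> a \<le> b \<longrightarrow> b < 1 \<longrightarrow>
            emeasure M {a<..b} = ennreal (rderiv \<eta> b - rderiv \<eta> a)) \<and>
        emeasure M (UNIV - {0<..<1}) = 0 \<and>
        N \<in> sets borel \<and> emeasure lborel N = 0 \<and> emeasure \<nu> (UNIV - N) = 0 \<and>
        (\<forall>A\<in>sets borel. emeasure M A = (\<integral>\<^sup>+ x\<in>A. ennreal (f x) \<partial>lborel) + emeasure \<nu> A))"

definition D :: "(real \<Rightarrow> real) \<Rightarrow> ennreal" where
  "D \<eta> = 2 * (\<integral>\<^sup>+ x\<in>{0<..<1}. ennreal (sqrt ((SOME f. ac_density \<eta> f) x)) \<partial>lborel)"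

end

theory Submission
  imports Defs
begin


text \<open>
  Write \<open>\<eta>'' = f dx + \<nu>\<close>. Integrating twice from the prescribed slope at 0, the obstacle
  \<open>\<eta> \<ge> \<xi>\<close> becomes a family of upper bounds on \<open>\<integral>\<^sub>t\<^sup>1 (\<integral>\<^sub>0\<^sup>s f + \<nu>(0,s]) ds\<close>, so that the densities that
  occur form a convex set, closed under almost everywhere limits by Fatou and bounded in
  \<open>L\<^sup>1\<close>. On such a set a maximizing sequence of \<open>\<integral>\<surd>f\<close> is Cauchy for \<open>\<surd>f\<close> in \<open>L\<^sup>1\<close>, by the strict
  concavity of the square root, hence a maximizing density exists and is unique. A
  maximizing \<open>\<eta>\<close> has \<open>\<nu> = 0\<close>: otherwise mass \<open>m = \<nu>(0,x]\<close> could be replaced by the density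
  \<open>m\<close> on \<open>(x,1)\<close>, which respects the bounds and increases \<open>\<integral>\<surd>f\<close>.
\<close>

text \<open>A competitor has its value prescribed at 1 and its slope at 0, while its value at 0 is
  free. So it is recovered by integrating the slope backwards from 1, and each constraint is an
  upper bound on a nonnegative quantity. That is why mass lost in a limit does no harm, why
  discarding the singular part keeps a density feasible, and why every feasible density comes from a
  competitor. Weak limits of the measures \<eta>'' would not help directly: the absolutely
  continuous part is not continuous under them. Strict concavity instead yields almost everywhere
  convergence of the densities themselves. The convergence of the series beyond 1 makes \<xi>
  Lipschitz at 1. As \<eta> lies above \<xi> and meets it at 1, its slope stays bounded there, and
  the same constant bounds the densities in L1. \<open>D\<close> refers to a density picked by
  \<open>SOME\<close>. Whichever density is picked for a competitor is feasible, which gives the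
  upper bound; almost everywhere uniqueness serves to evaluate \<open>D\<close> at the constructed
  maximizer.\<close>

section \<open>Maximizing the integral of the square root\<close>

text \<open>Quantitative strict concavity. With u, v the two roots and \<delta> the concavity gap,
  (u - v)^2 = 4 \<delta> (w + (u + v)/2) is at most 8 \<delta> w, and the arithmetic-geometric mean
  inequality with weight \<open>e\<close> splits this product. The resulting bound is linear in w
  and \<delta>, so it can be integrated term by term, and \<open>e\<close> can be tuned later to the
  distance from the supremum.\<close>

lemma sqrt_midpoint_gap:
  fixes a b e :: real
  assumes "0 \<le> a" "0 \<le> b" "0 < e"
  defines "w \<equiv> sqrt ((a + b) / 2)"
  shows "\<bar>sqrt a - sqrt b\<bar> \<le> e * w + 2 / e * (w - (sqrt a + sqrt b) / 2)"
proof -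
  define u v where uv: "u = sqrt a" "v = sqrt b"
  define \<delta> where "\<delta> = w - (u + v) / 2"
  have nn: "u \<ge> 0" "v \<ge> 0" "w \<ge> 0" using assms by (auto simp: uv)
  have ab: "u\<^sup>2 = a" "v\<^sup>2 = b" using assms by (auto simp: uv)
  have ww: "w\<^sup>2 = (u\<^sup>2 + v\<^sup>2) / 2" using assms ab by simp
  have sq: "((u + v) / 2)\<^sup>2 \<le> w\<^sup>2"
  proof -
    have "w\<^sup>2 - ((u + v) / 2)\<^sup>2 = ((u - v) / 2)\<^sup>2"
      unfolding ww by (simp add: power2_eq_square field_simps)
    then show ?thesis using zero_le_power2[of "(u - v) / 2"] by linarith
  qed
  then have d0: "\<delta> \<ge> 0" using nn power2_le_imp_le[OF sq] by (simp add: \<delta>_def)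
  have "(u - v)\<^sup>2 = 4 * ((w - (u + v) / 2) * (w + (u + v) / 2))"
    using ww by (simp add: power2_eq_square field_simps)
  also have "\<dots> \<le> 4 * (\<delta> * (2 * w))"
    using d0 by (intro mult_left_mono mult_mono) (auto simp: \<delta>_def nn)
  also have "\<dots> = 4 * (e * w) * (2 / e * \<delta>)" using assms by simp
  also have "\<dots> \<le> (e * w + 2 / e * \<delta>)\<^sup>2"
  proof -
    have "(e * w + 2 / e * \<delta>)\<^sup>2 - 4 * (e * w) * (2 / e * \<delta>) = (e * w - 2 / e * \<delta>)\<^sup>2"
      by (simp add: power2_eq_square algebra_simps)
    then show ?thesis by (metis diff_ge_0_iff_ge zero_le_power2)
  qed
  finally have "(u - v)\<^sup>2 \<le> (e * w + 2 / e * \<delta>)\<^sup>2" .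
  then have "\<bar>u - v\<bar> \<le> \<bar>e * w + 2 / e * \<delta>\<bar>" by (simp add: abs_le_square_iff)
  moreover have "e * w + 2 / e * \<delta> \<ge> 0" using nn d0 assms by simp
  ultimately show ?thesis by (simp add: uv \<delta>_def)
qed

lemma sqrt_le_one_plus:
  fixes x :: real assumes "0 \<le> x" shows "sqrt x \<le> 1 + x"
  using assms by (intro real_le_lsqrt) (auto simp: power2_eq_square algebra_simps)

text \<open>The telescoping argument behind completeness of L1. The envelope \<open>W\<close> also
  gives convergence of the integrals by dominated convergence; Fatou would only bound the integral
  of the limit from above, whereas a maximizer needs a bound from below.\<close>

lemma AE_convergent_of_L1_summable_increments:
  fixes u :: "nat \<Rightarrow> 'a \<Rightarrow> real"
  assumes int: "\<And>n. integrable M (u n)"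
    and inc: "\<And>n. (\<integral>x. \<bar>u (Suc n) x - u n x\<bar> \<partial>M) \<le> b n" and b: "summable b"
  obtains g where "g \<in> borel_measurable M" "AE x in M. (\<lambda>n. u n x) \<longlonglongrightarrow> g x"
    "integrable M g" "(\<lambda>n. \<integral>x. u n x \<partial>M) \<longlonglongrightarrow> (\<integral>x. g x \<partial>M)"
proof -
  let ?d = "\<lambda>n x. \<bar>u (Suc n) x - u n x\<bar>"
  have id: "integrable M (?d n)" for n using int by simp
  have sumI: "summable (\<lambda>n. \<integral>x. norm (?d n x) \<partial>M)"
    using inc by (intro summable_comparison_test[OF _ b]) auto
  have [measurable]: "u n \<in> borel_measurable M" for n using int by auto
  have "(\<integral>\<^sup>+x. (\<Sum>n. ennreal (?d n x)) \<partial>M) = (\<Sum>n. \<integral>\<^sup>+x. ennreal (?d n x) \<partial>M)"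
    by (rule nn_integral_suminf) auto
  also have "\<dots> = (\<Sum>n. ennreal (\<integral>x. ?d n x \<partial>M))"
    using id by (subst nn_integral_eq_integral) auto
  also have "\<dots> < top"
    using sumI by (subst suminf_ennreal2) auto
  finally have fin: "(\<integral>\<^sup>+x. (\<Sum>n. ennreal (?d n x)) \<partial>M) \<noteq> \<infinity>" by auto
  have "AE x in M. (\<Sum>n. ennreal (?d n x)) \<noteq> \<infinity>"
    by (rule nn_integral_PInf_AE[OF _ fin]) auto
  then have S: "AE x in M. summable (\<lambda>n. ?d n x)"
    by eventually_elim (auto intro!: summable_suminf_not_top)
  define W where "W = (\<lambda>x. \<bar>u 0 x\<bar> + (\<Sum>n. ?d n x))"
  have iW: "integrable M W"
    unfolding W_def using int id S sumI by (intro Bochner_Integration.integrable_add integrable_suminf) auto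
  have tele: "u n x = u 0 x + (\<Sum>k<n. u (Suc k) x - u k x)" for n x
    by (subst sum_lessThan_telescope) simp
  define g where "g = (\<lambda>x. lim (\<lambda>n. u n x))"
  have [measurable]: "g \<in> borel_measurable M" unfolding g_def by measurable
  have conv: "AE x in M. (\<lambda>n. u n x) \<longlonglongrightarrow> g x"
    using S
  proof eventually_elim
    case (elim x)
    then have "summable (\<lambda>n. u (Suc n) x - u n x)" by (rule summable_rabs_cancel)
    then have "(\<lambda>n. \<Sum>k<n. u (Suc k) x - u k x) \<longlonglongrightarrow> (\<Sum>n. u (Suc n) x - u n x)"
      by (rule summable_LIMSEQ)
    then have "(\<lambda>n. u 0 x + (\<Sum>k<n. u (Suc k) x - u k x)) \<longlonglongrightarrow> u 0 x + (\<Sum>n. u (Suc n) x - u n x)"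
      by (intro tendsto_add tendsto_const)
    then have "(\<lambda>n. u n x) \<longlonglongrightarrow> u 0 x + (\<Sum>n. u (Suc n) x - u n x)" by (simp only: tele[symmetric])
    then have "convergent (\<lambda>n. u n x)" by (rule convergentI)
    then show ?case by (simp add: g_def convergent_LIMSEQ_iff)
  qed
  have bd: "AE x in M. norm (u n x) \<le> W x" for n
    using S
  proof eventually_elim
    case (elim x)
    have "\<bar>u n x\<bar> \<le> \<bar>u 0 x\<bar> + \<bar>\<Sum>k<n. u (Suc k) x - u k x\<bar>" by (subst tele) (rule abs_triangle_ineq)
    also have "\<dots> \<le> \<bar>u 0 x\<bar> + (\<Sum>k<n. ?d k x)" by (intro add_left_mono sum_abs)
    also have "\<dots> \<le> W x" unfolding W_def using elim by (intro add_left_mono sum_le_suminf) auto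
    finally show ?case by simp
  qed
  have "integrable M g" 
    by (rule integrable_dominated_convergence[OF _ _ iW conv bd]) measurable
  moreover have "(\<lambda>n. \<integral>x. u n x \<partial>M) \<longlonglongrightarrow> (\<integral>x. g x \<partial>M)"
    by (rule integral_dominated_convergence[OF _ _ iW conv bd]) measurable
  ultimately show ?thesis using conv by (intro that[of g]) simp_all
qed

text \<open>The analogue of projecting onto a closed convex set: midpoints stay in \<open>S\<close>,
  so two near-maximizers cannot have a large concavity gap and their roots are close in L1.
  Closedness is asked only up to null sets, because a limit measurable for \<open>M\<close> may need
  another representative to satisfy the constraints that define \<open>S\<close>.\<close>

theorem (in finite_measure) integral_sqrt_unique_maximizer:
  fixes S :: "('a \<Rightarrow> real) set" and C :: real
  assumes ne: "S \<noteq> {}"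
    and meas: "\<And>f. f \<in> S \<Longrightarrow> f \<in> borel_measurable M"
    and nn: "\<And>f x. f \<in> S \<Longrightarrow> 0 \<le> f x"
    and bdd: "\<And>f. f \<in> S \<Longrightarrow> (\<integral>\<^sup>+x. ennreal (f x) \<partial>M) \<le> ennreal C"
    and mid: "\<And>f g. f \<in> S \<Longrightarrow> g \<in> S \<Longrightarrow> (\<lambda>x. (f x + g x) / 2) \<in> S"
    and closed: "\<And>F f. (\<And>n. F n \<in> S) \<Longrightarrow> f \<in> borel_measurable M \<Longrightarrow> (\<And>x. 0 \<le> f x) \<Longrightarrow>
        (AE x in M. (\<lambda>n. F n x) \<longlonglongrightarrow> f x) \<Longrightarrow> \<exists>f'\<in>S. AE x in M. f' x = f x"
  shows "(\<forall>f\<in>S. integrable M (\<lambda>x. sqrt (f x))) \<and> (\<exists>f\<in>S. \<forall>g\<in>S. (\<integral>x. sqrt (g x) \<partial>M) \<le> (\<integral>x. sqrt (f x) \<partial>M) \<and>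
     ((\<integral>x. sqrt (g x) \<partial>M) = (\<integral>x. sqrt (f x) \<partial>M) \<longrightarrow> (AE x in M. g x = f x)))"
proof -
  define J where "J = (\<lambda>f::'a \<Rightarrow> real. \<integral>x. sqrt (f x) \<partial>M)"
  have intf: "integrable M f" if "f \<in> S" for f
    using that meas nn bdd[OF that]
    by (intro integrableI_nonneg) (auto simp: le_less_trans[OF _ ennreal_less_top])
  have ints: "integrable M (\<lambda>x. sqrt (f x))" if "f \<in> S" for f
  proof (rule Bochner_Integration.integrable_bound[of _ "\<lambda>x. 1 + f x"])
    show "integrable M (\<lambda>x. 1 + f x)" using intf[OF that] by simp
    show "(\<lambda>x. sqrt (f x)) \<in> borel_measurable M" using meas[OF that] by measurable
    show "AE x in M. norm (sqrt (f x)) \<le> norm (1 + f x)"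
      using nn[OF that] sqrt_le_one_plus by auto
  qed
  \<comment> \<open>A common bound for \<open>J\<close> on \<open>S\<close>, from
    \<open>sqrt y\<close> at most 1 + y. The \<open>max\<close> covers a negative \<open>C\<close>,
    which \<open>ennreal\<close> truncates to 0.\<close>
  define K where "K = measure M (space M) + max C 0"
  have K0: "K \<ge> 0" by (simp add: K_def)
  have JK: "J f \<le> K" if "f \<in> S" for f
  proof -
    have "J f \<le> (\<integral>x. 1 + f x \<partial>M)" unfolding J_def
      using nn[OF that] sqrt_le_one_plus intf[OF that] ints[OF that] by (intro integral_mono) auto
    also have "\<dots> = measure M (space M) + (\<integral>x. f x \<partial>M)" using intf[OF that] by simp
    also have "(\<integral>x. f x \<partial>M) \<le> max C 0"
    proof -
      have "ennreal (\<integral>x. f x \<partial>M) \<le> ennreal (max C 0)"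
        using bdd[OF that] nn_integral_eq_integral[OF intf[OF that]] nn[OF that]
        by (metis (no_types, lifting) AE_I2 ennreal_leI max.cobounded1 order_trans)
      then show ?thesis by (simp add: ennreal_le_iff)
    qed
    finally show ?thesis by (simp add: K_def)
  qed
  define s where "s = (SUP f\<in>S. J f)"
  have bda: "bdd_above (J ` S)" using JK by (auto simp: bdd_above_def)
  have Js: "J f \<le> s" if "f \<in> S" for f unfolding s_def using that bda by (rule cSUP_upper)
  \<comment> \<open>The value of \<open>J\<close> at the midpoint is used twice: bounded by
    \<open>K\<close> in the term with \<open>e\<close>, and by the supremum \<open>s\<close> in the
    gap.\<close>
  have key: "(\<integral>x. \<bar>sqrt (f x) - sqrt (g x)\<bar> \<partial>M) \<le> e * K + 2 / e * (s - (J f + J g) / 2)"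
    if "f \<in> S" "g \<in> S" "e > 0" for f g e
  proof -
    let ?w = "\<lambda>x. sqrt ((f x + g x) / 2)"
    note m = mid[OF that(1,2)]
    have "(\<integral>x. \<bar>sqrt (f x) - sqrt (g x)\<bar> \<partial>M)
        \<le> (\<integral>x. e * ?w x + 2 / e * (?w x - (sqrt (f x) + sqrt (g x)) / 2) \<partial>M)"
      using that nn ints[OF that(1)] ints[OF that(2)] ints[OF m] sqrt_midpoint_gap
      by (intro integral_mono) auto
    also have "\<dots> = e * J (\<lambda>x. (f x + g x) / 2) + 2 / e * (J (\<lambda>x. (f x + g x) / 2) - (J f + J g) / 2)"
      using ints[OF that(1)] ints[OF that(2)] ints[OF m] unfolding J_def by simp
    also have "\<dots> \<le> e * K + 2 / e * (s - (J f + J g) / 2)"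
      using that JK[OF m] Js[OF m] by (intro add_mono mult_left_mono diff_right_mono) auto
    finally show ?thesis .
  qed
  \<comment> \<open>Errors (1/4)^n are matched below with the weight e = (1/2)^n: both terms of
    \<open>key\<close> then have order (1/2)^n, which is summable.\<close>
  have "\<exists>f\<in>S. J f > s - (1/4)^n" for n :: nat
    using less_cSUP_iff[OF ne bda, of "s - (1/4)^n"] by (simp add: s_def)
  then obtain F where F: "\<And>n. F n \<in> S" "\<And>n::nat. J (F n) > s - (1/4)^n" by metis
  have inc: "(\<integral>x. \<bar>sqrt (F (Suc n) x) - sqrt (F n x)\<bar> \<partial>M) \<le> (K + 2) * (1/2)^n" for n
  proof -
    have "(1/4::real)^Suc n \<le> (1/4)^n" by simp
    then have "s - (J (F (Suc n)) + J (F n)) / 2 \<le> (1/4)^n"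
    proof -
      have "s - (1/4)^n < J (F (Suc n))"
        by (rule le_less_trans[OF _ F(2)[of "Suc n"]]) (rule diff_left_mono, fact)
      then show ?thesis using F(2)[of n] by (simp add: field_simps)
    qed
    then have "(1/2)^n * K + 2 / (1/2)^n * (s - (J (F (Suc n)) + J (F n)) / 2)
       \<le> (1/2)^n * K + 2 / (1/2)^n * (1/4)^n"
      by (intro add_left_mono mult_left_mono) auto
    also have "\<dots> = (K + 2) * (1/2)^n"
    proof -
      have "(1/4::real)^n = (1/2)^n * (1/2)^n" by (simp add: power_mult_distrib[symmetric])
      then show ?thesis by (simp add: algebra_simps)
    qed
    finally show ?thesis using key[OF F(1) F(1), of "(1/2)^n" "Suc n" n] by simp
  qed
  have "summable (\<lambda>n. (K + 2) * (1/2::real)^n)" by (intro summable_mult summable_geometric) auto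
  from AE_convergent_of_L1_summable_increments[OF ints[OF F(1)] inc this]
  obtain g where g: "g \<in> borel_measurable M" "AE x in M. (\<lambda>n. sqrt (F n x)) \<longlonglongrightarrow> g x"
    "integrable M g" "(\<lambda>n. J (F n)) \<longlonglongrightarrow> (\<integral>x. g x \<partial>M)" unfolding J_def by blast
  \<comment> \<open>The convergent objects are the roots; squaring them returns to the densities, so
    the candidate maximizer is the square of \<open>g\<close>.\<close>
  have "AE x in M. (\<lambda>n. F n x) \<longlonglongrightarrow> (g x)\<^sup>2"
    using g(2)
  proof eventually_elim
    case (elim x)
    then have "(\<lambda>n. (sqrt (F n x))\<^sup>2) \<longlonglongrightarrow> (g x)\<^sup>2" by (rule tendsto_power)
    then show ?case using nn[OF F(1)] by simp
  qed
  from closed[OF F(1) _ _ this] g(1) obtain f where f: "f \<in> S" "AE x in M. f x = (g x)\<^sup>2" by auto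
  have gnn: "AE x in M. g x \<ge> 0" using g(2)
  proof eventually_elim
    case (elim x) then show ?case by (rule LIMSEQ_le_const) (use nn[OF F(1)] in auto)
  qed
  have "AE x in M. sqrt (f x) = g x" using f(2) gnn by eventually_elim auto
  then have Jf: "J f = (\<integral>x. g x \<partial>M)" unfolding J_def
    using g(1) meas[OF f(1)] by (intro integral_cong_AE) auto
  have "(\<lambda>n. s - (1/4::real)^n) \<longlonglongrightarrow> s - 0" by (intro tendsto_intros) auto
  then have "s - 0 \<le> J f" unfolding Jf using g(4) F(2) by (intro LIMSEQ_le) (auto intro: less_imp_le)
  then have Jfs: "J f = s" using Js[OF f(1)] by simp
  \<comment> \<open>For two exact maximizers the gap term of \<open>key\<close> vanishes, and
    \<open>e\<close> may tend to 0.\<close>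
  have uniq: "AE x in M. g x = f x" if "g \<in> S" "J g = s" for g
  proof -
    let ?I = "\<integral>x. \<bar>sqrt (f x) - sqrt (g x)\<bar> \<partial>M"
    have "?I \<le> e * K" if "e > 0" for e using key[OF f(1) \<open>g \<in> S\<close> that] Jfs \<open>J g = s\<close> by simp
    then have I0: "?I \<le> 0"
    proof -
      assume *: "\<And>e. e > 0 \<Longrightarrow> ?I \<le> e * K"
      show ?thesis
      proof (rule field_le_epsilon)
        fix e :: real assume "e > 0"
        then have "?I \<le> e / (K + 1) * K" using *[of "e / (K + 1)"] K0 by simp
        also have "\<dots> \<le> e" using \<open>e > 0\<close> K0 by (simp add: field_simps)
        finally show "?I \<le> 0 + e" by simp
      qed
    qed
    have "?I = 0" using I0 by (intro antisym) auto
    then have "AE x in M. \<bar>sqrt (f x) - sqrt (g x)\<bar> = 0"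
      using ints[OF f(1)] ints[OF that(1)] by (subst (asm) integral_nonneg_eq_0_iff_AE) auto
    then show ?thesis by eventually_elim (auto)
  qed
  have "\<forall>g\<in>S. J g \<le> J f \<and> (J g = J f \<longrightarrow> (AE x in M. g x = f x))"
    using Js Jfs uniq by auto
  with f(1) ints show ?thesis unfolding J_def by blast
qed



section \<open>Convex functions on the unit interval and their slopes\<close>

text \<open>For convex \<open>\<eta>\<close> such an \<open>R\<close> is a selection of the subdifferential.\<close>

definition slope_bracket :: "(real \<Rightarrow> real) \<Rightarrow> (real \<Rightarrow> real) \<Rightarrow> bool" where
  "slope_bracket \<eta> R \<longleftrightarrow>
     (\<forall>x y. 0 \<le> x \<longrightarrow> x \<le> y \<longrightarrow> y \<le> 1 \<longrightarrow> R x * (y - x) \<le> \<eta> y - \<eta> x \<and> \<eta> y - \<eta> x \<le> R y * (y - x))"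

lemma slope_bracketD:
  assumes "slope_bracket \<eta> R" "0 \<le> x" "x \<le> y" "y \<le> 1"
  shows "R x * (y - x) \<le> \<eta> y - \<eta> x" "\<eta> y - \<eta> x \<le> R y * (y - x)"
  using assms unfolding slope_bracket_def by blast+

lemma slope_bracket_mono:
  assumes "slope_bracket \<eta> R" shows "mono_on {0..1} R"
proof (rule mono_onI)
  fix x y :: real assume "x \<in> {0..1}" "y \<in> {0..1}" "x \<le> y"
  then have "R x * (y - x) \<le> R y * (y - x)"
    using slope_bracketD[OF assms, of x y] by auto
  then show "R x \<le> R y" using \<open>x \<le> y\<close> by (cases "x = y") auto
qed

text \<open>\<open>R z\<close> separates the slopes of the two chords that meet at an intermediate
  point z.\<close>

lemma slope_bracket_convex:
  assumes "slope_bracket \<eta> R" shows "convex_on {0..1} \<eta>"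
proof (rule convex_on_linorderI)
  fix t x y :: real assume t: "t > 0" "t < 1" and xy: "x \<in> {0..1}" "y \<in> {0..1}" "x < y"
  define z where "z = (1 - t) *\<^sub>R x + t *\<^sub>R y"
  have zx: "z - x = t * (y - x)" and yz: "y - z = (1 - t) * (y - x)"
    by (auto simp: z_def algebra_simps)
  have "0 \<le> z - x" "0 \<le> y - z" unfolding zx yz using t xy by auto
  then have z: "x \<le> z" "z \<le> y" by simp_all
  then have z01: "0 \<le> x" "0 \<le> z" "z \<le> 1" "y \<le> 1" using xy by auto
  have "\<eta> z - \<eta> x \<le> R z * (t * (y - x))"
    using slope_bracketD(2)[OF assms z01(1) z(1) z01(3)] unfolding zx .
  moreover have "R z * ((1 - t) * (y - x)) \<le> \<eta> y - \<eta> z"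
    using slope_bracketD(1)[OF assms z01(2) z(2) z01(4)] unfolding yz .
  ultimately have "(1 - t) * (\<eta> z - \<eta> x) \<le> (1 - t) * (R z * (t * (y - x)))"
     "t * (R z * ((1 - t) * (y - x))) \<le> t * (\<eta> y - \<eta> z)"
    using t by (auto intro!: mult_left_mono)
  moreover have "(1 - t) * (R z * (t * (y - x))) = t * (R z * ((1 - t) * (y - x)))" by (simp only: mult_ac)
  ultimately have "(1 - t) * (\<eta> z - \<eta> x) \<le> t * (\<eta> y - \<eta> z)" by (metis order_trans)
  then show "\<eta> ((1 - t) *\<^sub>R x + t *\<^sub>R y) \<le> (1 - t) * \<eta> x + t * \<eta> y"
    unfolding z_def[symmetric] by (simp add: algebra_simps)
qed simp

lemma slope_bracket_abs_diff_le:
  assumes "slope_bracket \<eta> R" "x \<in> {0..1}" "y \<in> {0..1}"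
  shows "\<bar>\<eta> x - \<eta> y\<bar> \<le> max \<bar>R 0\<bar> \<bar>R 1\<bar> * \<bar>x - y\<bar>"
proof -
  define K where "K = max \<bar>R 0\<bar> \<bar>R 1\<bar>"
  have *: "\<bar>\<eta> x - \<eta> y\<bar> \<le> K * \<bar>x - y\<bar>" if "x \<in> {0..1}" "y \<in> {0..1}" "x \<le> y" for x y
  proof -
    have "R 0 \<le> R x" "R y \<le> R 1"
      using slope_bracket_mono[OF assms(1)] that by (auto simp: mono_on_def)
    then have R: "- K \<le> R x" "R y \<le> K" by (auto simp: K_def)
    have "- K * (y - x) \<le> R x * (y - x)" by (rule mult_right_mono) (use R that in auto)
    moreover have "R y * (y - x) \<le> K * (y - x)" by (rule mult_right_mono) (use R that in auto)
    ultimately show ?thesis using slope_bracketD[OF assms(1), of x y] that by auto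
  qed
  show ?thesis
    using *[of x y] *[of y x] assms unfolding K_def[symmetric] by (cases "x \<le> y") (auto simp: abs_minus_commute)
qed

lemma slope_bracket_continuous:
  assumes "slope_bracket \<eta> R" shows "continuous_on {0..1} \<eta>"
proof -
  define K where "K = max \<bar>R 0\<bar> \<bar>R 1\<bar> + 1"
  have K: "K > 0" by (simp add: K_def)
  show ?thesis
  proof (subst continuous_on_iff, intro ballI allI impI)
    fix x e :: real assume x: "x \<in> {0..1}" and "e > 0"
    have "dist (\<eta> x') (\<eta> x) < e" if "x' \<in> {0..1}" "dist x' x < e / K" for x'
    proof -
      have "\<bar>\<eta> x' - \<eta> x\<bar> \<le> max \<bar>R 0\<bar> \<bar>R 1\<bar> * \<bar>x' - x\<bar>" using slope_bracket_abs_diff_le assms that x by blast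
      also have "\<dots> \<le> K * \<bar>x' - x\<bar>" by (auto simp: K_def intro!: mult_right_mono)
      also have "\<dots> < e" using that K by (simp add: dist_real_def field_simps)
      finally show ?thesis by (simp add: dist_real_def)
    qed
    then show "\<exists>d>0. \<forall>x'\<in>{0..1}. dist x' x < d \<longrightarrow> dist (\<eta> x') (\<eta> x) < e"
      using \<open>e > 0\<close> K by (intro exI[of _ "e / K"]) auto
  qed
qed

text \<open>On a partition into n + 1 equal steps the bounds telescope to (R b - R a)(b - a)/(n +
  1), which tends to 0. This identifies functions with the same slopes without differentiating
  them.\<close>

lemma eq_endpoints_of_superadditive_bound:
  fixes H R :: "real \<Rightarrow> real"
  assumes "a \<le> b"
    and bd: "\<And>x y. a \<le> x \<Longrightarrow> x \<le> y \<Longrightarrow> y \<le> b \<Longrightarrow> \<bar>H y - H x\<bar> \<le> (R y - R x) * (y - x)"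
  shows "H b = H a"
proof -
  have n: "\<bar>H b - H a\<bar> \<le> (R b - R a) * (b - a) / real (Suc n)" for n
  proof -
    define \<delta> where "\<delta> = (b - a) / real (Suc n)"
    define p where "p = (\<lambda>i. a + real i * \<delta>)"
    have d0: "\<delta> \<ge> 0" using assms(1) by (simp add: \<delta>_def)
    have p0: "p 0 = a" "p (Suc n) = b" by (auto simp: p_def \<delta>_def)
    have step: "p (Suc i) - p i = \<delta>" for i by (simp add: p_def algebra_simps)
    have pa: "p i \<ge> a" for i using d0 by (simp add: p_def)
    have pm: "p i \<le> p j" if "i \<le> j" for i j using d0 that by (auto simp: p_def intro!: mult_right_mono)
    have "\<bar>H b - H a\<bar> = \<bar>\<Sum>i<Suc n. H (p (Suc i)) - H (p i)\<bar>"
      by (subst sum_lessThan_telescope) (simp add: p0)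
    also have "\<dots> \<le> (\<Sum>i<Suc n. \<bar>H (p (Suc i)) - H (p i)\<bar>)" by (rule sum_abs)
    also have "\<dots> \<le> (\<Sum>i<Suc n. (R (p (Suc i)) - R (p i)) * \<delta>)"
    proof (rule sum_mono)
      fix i assume "i \<in> {..<Suc n}"
      then have "p (Suc i) \<le> b" using pm[of "Suc i" "Suc n"] p0 by simp
      then show "\<bar>H (p (Suc i)) - H (p i)\<bar> \<le> (R (p (Suc i)) - R (p i)) * \<delta>"
        using bd[OF pa pm, of i "Suc i"] step by simp
    qed
    also have "\<dots> = (R b - R a) * \<delta>"
      by (subst sum_distrib_right[symmetric], subst sum_lessThan_telescope) (simp add: p0)
    finally show ?thesis by (simp add: \<delta>_def)
  qed
  have "(\<lambda>n. (R b - R a) * (b - a) / real (Suc n)) \<longlonglongrightarrow> 0"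
    by (rule LIMSEQ_Suc[OF lim_const_over_n])
  then have "\<bar>H b - H a\<bar> \<le> 0" using n by (intro LIMSEQ_le_const) auto
  then show ?thesis by simp
qed

lemma mono_integral_bounds:
  fixes R :: "real \<Rightarrow> real"
  assumes "mono_on {a..b} R" "a \<le> b"
  shows "R integrable_on {a..b}" "R a * (b - a) \<le> integral {a..b} R" "integral {a..b} R \<le> R b * (b - a)"
proof -
  show i: "R integrable_on {a..b}" using assms by (intro integrable_on_mono_on)
  have "integral {a..b} (\<lambda>_. R a) \<le> integral {a..b} R"
    using assms i by (intro integral_le) (auto simp: mono_on_def)
  then show "R a * (b - a) \<le> integral {a..b} R" using assms by (simp add: mult.commute)
  have "integral {a..b} R \<le> integral {a..b} (\<lambda>_. R b)"
    using assms i by (intro integral_le) (auto simp: mono_on_def)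
  then show "integral {a..b} R \<le> R b * (b - a)" using assms by (simp add: mult.commute)
qed

lemma mono_integral_diff:
  fixes R :: "real \<Rightarrow> real"
  assumes "mono_on {0..1} R" "0 \<le> x" "x \<le> y" "y \<le> 1"
  shows "integral {0..y} R - integral {0..x} R = integral {x..y} R"
proof -
  have "R integrable_on {0..y}"
    using assms by (intro integrable_on_mono_on mono_on_subset[OF assms(1)]) auto
  then show ?thesis using Henstock_Kurzweil_Integration.integral_combine[of 0 x y R] assms by simp
qed

lemma slope_bracket_integral:
  assumes "mono_on {0..1} R"
  shows "slope_bracket (\<lambda>t. k + integral {0..t} R) R"
  unfolding slope_bracket_def
proof (intro allI impI)
  fix x y :: real assume *: "0 \<le> x" "x \<le> y" "y \<le> 1"
  have m: "mono_on {x..y} R" using * by (intro mono_on_subset[OF assms]) auto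
  show "R x * (y - x) \<le> k + integral {0..y} R - (k + integral {0..x} R) \<and>
     k + integral {0..y} R - (k + integral {0..x} R) \<le> R y * (y - x)"
    using mono_integral_bounds[OF m] mono_integral_diff[OF assms *] * by simp
qed

text \<open>Both \<eta> and the indefinite integral of \<open>R\<close> are bracketed by
  \<open>R\<close>, so over [x, y] their increments differ by at most (R y - R x)(y - x), and the
  partition argument applies to the difference.\<close>

lemma slope_bracket_increment:
  assumes "slope_bracket \<eta> R" "0 \<le> a" "a \<le> b" "b \<le> 1"
  shows "\<eta> b - \<eta> a = integral {a..b} R"
proof -
  note m = slope_bracket_mono[OF assms(1)]
  define H where "H = (\<lambda>t. \<eta> t - integral {0..t} R)"
  have "H b = H a"
  proof (rule eq_endpoints_of_superadditive_bound[OF assms(3)])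
    fix x y assume "a \<le> x" "x \<le> y" "y \<le> b"
    then have *: "0 \<le> x" "x \<le> y" "y \<le> 1" using assms by auto
    show "\<bar>H y - H x\<bar> \<le> (R y - R x) * (y - x)"
      using slope_bracketD[OF assms(1) *] slope_bracketD[OF slope_bracket_integral[OF m, of 0] *]
      by (simp add: H_def algebra_simps abs_le_iff)
  qed
  then show ?thesis using mono_integral_diff[OF m assms(2-4)] by (simp add: H_def)
qed

text \<open>The bracket squeezes the difference quotient over [x, y] between \<open>R x\<close> and
  \<open>R y\<close>.\<close>

lemma slope_bracket_has_right_derivative:
  assumes "slope_bracket \<eta> R" "0 \<le> x" "x < 1" "(R \<longlongrightarrow> R x) (at_right x)"
  shows "(\<eta> has_real_derivative R x) (at_right x)"
  unfolding has_field_derivative_iff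
proof (rule tendsto_sandwich[OF _ _ tendsto_const assms(4)])
  have ev: "\<forall>\<^sub>F y in at_right x. x < y \<and> y < 1"
    using assms(3) by (auto simp: eventually_at_right_field)
  show "\<forall>\<^sub>F y in at_right x. R x \<le> (\<eta> y - \<eta> x) / (y - x)"
    using ev
  proof eventually_elim
    case (elim y) then show ?case using slope_bracketD(1)[OF assms(1,2), of y] by (simp add: pos_le_divide_eq)
  qed
  show "\<forall>\<^sub>F y in at_right x. (\<eta> y - \<eta> x) / (y - x) \<le> R y"
    using ev
  proof eventually_elim
    case (elim y) then show ?case using slope_bracketD(2)[OF assms(1,2), of y] by (simp add: pos_divide_le_eq)
  qed
qed

lemma rderiv_eqI:
  assumes "(\<eta> has_real_derivative d) (at_right x)" shows "rderiv \<eta> x = d"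
  unfolding rderiv_def
proof (rule the_equality[of "\<lambda>d. (\<eta> has_real_derivative d) (at_right x)", OF assms])
  fix d' assume "(\<eta> has_real_derivative d') (at_right x)"
  with assms show "d' = d"
    unfolding has_field_derivative_iff by (intro tendsto_unique[OF trivial_limit_at_right_real]) 
qed

text \<open>On [0, 1) the selection is the right derivative, and \<open>C\<close> serves as its
  value at 1. A convex function can be vertical at an endpoint; \<open>d\<close> and
  \<open>C\<close> keep the slopes finite at 0 and at 1.\<close>

lemma convex_imp_slope_bracket:
  assumes cont: "continuous_on {0..1} \<eta>" and conv: "convex_on {0..1} \<eta>"
    and d: "(\<eta> has_real_derivative d) (at_right 0)"
    and C: "\<And>t. t \<in> {0..1} \<Longrightarrow> \<eta> 1 - \<eta> t \<le> C * (1 - t)"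
  obtains R where "slope_bracket \<eta> R" "R 0 = d" "\<And>x. 0 \<le> x \<Longrightarrow> x < 1 \<Longrightarrow> (R \<longlongrightarrow> R x) (at_right x)"
    "\<And>x. 0 \<le> x \<Longrightarrow> x < 1 \<Longrightarrow> rderiv \<eta> x = R x"
proof -
  define s where "s = (\<lambda>x y. (\<eta> y - \<eta> x) / (y - x))"
  have s_sym: "s x y = (\<eta> x - \<eta> y) / (x - y)" for x y
    unfolding s_def by (metis minus_diff_eq minus_divide_divide)
  have s1: "s x t \<le> s x y" and s2: "s x y \<le> s t y" if "0 \<le> x" "x < t" "t < y" "y \<le> 1" for x t y
    using convex_on_slope_le[OF conv, of x y t] that by (auto simp: s_sym)
  \<comment> \<open>At 0 there is no chord to the left that could bound the slopes from below; the
    given right derivative takes its place.\<close>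
  have d_le: "d \<le> s 0 y" if "0 < y" "y \<le> 1" for y
  proof (rule tendsto_upperbound)
    show "((\<lambda>t. s 0 t) \<longlongrightarrow> d) (at_right 0)"
      using d unfolding has_field_derivative_iff s_def by simp
    have "\<forall>\<^sub>F t in at_right 0. 0 < t \<and> t < y" using that by (auto simp: eventually_at_right_field)
    then show "\<forall>\<^sub>F t in at_right 0. s 0 t \<le> s 0 y" by eventually_elim (use s1[of 0 _ y] that in auto)
  qed simp
  \<comment> \<open>The infimum of the chord slopes to the right is the right derivative. No such
    chord exists at 1, hence the separate value there.\<close>
  define R where "R = (\<lambda>x. if x < 1 then (INF y\<in>{x<..1}. s x y) else C)"
  have bdd: "bdd_below (s x ` {x<..1})" if "0 \<le> x" for x
  proof (cases "x = 0")
    case True then show ?thesis using d_le by (intro bdd_belowI2[of _ d]) auto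
  next
    case False
    have "s 0 x \<le> s x y" if "y \<in> {x<..1}" for y
      using s1[of 0 x y] s2[of 0 x y] that False \<open>0 \<le> x\<close> by auto
    then show ?thesis by (intro bdd_belowI2)
  qed
  have Rle: "R x \<le> s x y" if "0 \<le> x" "x < y" "y \<le> 1" for x y
    using that cINF_lower[OF bdd[of x], of y] by (auto simp: R_def)
  have leR: "m \<le> R x" if "x < 1" "\<And>y. x < y \<Longrightarrow> y \<le> 1 \<Longrightarrow> m \<le> s x y" for x m
    using that by (auto simp: R_def intro!: cINF_greatest)
  have sR: "s x y \<le> R y" if "0 \<le> x" "x < y" "y \<le> 1" for x y
  proof (cases "y < 1")
    case True
    have "s x y \<le> s y z" if "y < z" "z \<le> 1" for z
      using s1[of x y z] s2[of x y z] that \<open>0 \<le> x\<close> \<open>x < y\<close> by auto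
    then show ?thesis using True by (intro leR) auto
  next
    case False
    then show ?thesis using that C[of x] by (auto simp: R_def s_def pos_divide_le_eq)
  qed
  have br: "slope_bracket \<eta> R"
    unfolding slope_bracket_def
  proof (intro allI impI)
    fix x y :: real assume *: "0 \<le> x" "x \<le> y" "y \<le> 1"
    show "R x * (y - x) \<le> \<eta> y - \<eta> x \<and> \<eta> y - \<eta> x \<le> R y * (y - x)"
    proof (cases "x = y")
      case False
      then show ?thesis using Rle[of x y] sR[of x y] * by (auto simp: s_def pos_divide_le_eq pos_le_divide_eq)
    qed simp
  qed
  have mono: "R x \<le> R y" if "0 \<le> x" "x < y" "y \<le> 1" for x y
    using Rle[of x y] sR[of x y] that by linarith
  have rc: "(R \<longlongrightarrow> R x) (at_right x)" if x: "0 \<le> x" "x < 1" for x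
  proof (rule order_tendstoI)
    fix m assume "m < R x"
    have "\<forall>\<^sub>F y in at_right x. x < y \<and> y < 1" using x by (auto simp: eventually_at_right_field)
    then show "\<forall>\<^sub>F y in at_right x. m < R y"
    proof eventually_elim
      case (elim y) then show ?case using mono[of x y] x \<open>m < R x\<close> by auto
    qed
  next
    fix m assume "R x < m"
    then have "\<exists>z\<in>{x<..1}. s x z < m"
      using cINF_less_iff[OF _ bdd[OF x(1)], of m] x by (auto simp: R_def)
    then obtain z where z: "x < z" "z \<le> 1" "s x z < m" by auto
    have "(\<eta> \<longlongrightarrow> \<eta> x) (at x within {0..1})"
      using cont x by (auto simp: continuous_on_def)
    then have "(\<eta> \<longlongrightarrow> \<eta> x) (at x within {x..1})"
      by (rule tendsto_within_subset) (use x in auto)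
    then have "(\<eta> \<longlongrightarrow> \<eta> x) (at_right x)"
      using x by (simp add: at_within_Icc_at_right)
    then have "((\<lambda>y. s y z) \<longlongrightarrow> s x z) (at_right x)"
      unfolding s_def using z by (intro tendsto_intros) auto
    then have "\<forall>\<^sub>F y in at_right x. s y z < m" using z(3) by (rule order_tendstoD(2))
    moreover have "\<forall>\<^sub>F y in at_right x. x < y \<and> y < z" using z by (auto simp: eventually_at_right_field)
    ultimately show "\<forall>\<^sub>F y in at_right x. R y < m"
    proof eventually_elim
      case (elim y) then show ?case using Rle[of y z] x z by auto
    qed
  qed
  have rd: "rderiv \<eta> x = R x" if "0 \<le> x" "x < 1" for x
    by (rule rderiv_eqI[OF slope_bracket_has_right_derivative[OF br that rc[OF that]]])
  have "R 0 = d" using rd[of 0] rderiv_eqI[OF d] by simp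
  from that[OF br this rc rd] show ?thesis .
qed



section \<open>Elementary properties of the model\<close>

lemma xi_summable:
  assumes "is_model \<beta>" "\<bar>t\<bar> \<le> 1"
  shows "summable (\<lambda>p. if 2 \<le> p then (\<beta> p)\<^sup>2 * t ^ p else 0)"
proof -
  obtain \<epsilon> where e: "\<epsilon> > 0" "summable (\<lambda>p. if 2 \<le> p then (\<beta> p)\<^sup>2 * (1 + \<epsilon>) ^ p else 0)"
    using assms unfolding is_model_def by auto
  show ?thesis
  proof (rule summable_comparison_test[OF _ e(2)], intro exI[of _ 0] allI impI)
    fix p
    have "\<bar>t\<bar> ^ p \<le> (1 + \<epsilon>) ^ p" using assms e by (intro power_mono) auto
    then show "norm (if 2 \<le> p then (\<beta> p)\<^sup>2 * t ^ p else 0) \<le> (if 2 \<le> p then (\<beta> p)\<^sup>2 * (1 + \<epsilon>) ^ p else 0)"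
      by (auto simp: abs_mult power_abs intro!: mult_left_mono)
  qed
qed

lemma xi_le_xi_one:
  assumes "is_model \<beta>" "t \<in> {0..1}"
  shows "xi \<beta> t \<le> xi \<beta> 1"
  unfolding xi_def using assms
  by (intro suminf_le xi_summable) (auto intro!: mult_left_le power_le_one)

text \<open>The series starts in degree 2, so \<open>xi\<close> is bounded by a multiple of t^2 near
  0. Hence the slope prescribed in \<open>K_set\<close> is minus the square of
  \<open>h\<close>.\<close>

lemma deriv_xi_zero:
  assumes "is_model \<beta>" shows "deriv (xi \<beta>) 0 = 0"
proof (rule DERIV_imp_deriv)
  have bd: "\<bar>xi \<beta> t\<bar> \<le> t\<^sup>2 * xi \<beta> 1" if "\<bar>t\<bar> \<le> 1" for t
  proof -
    have s1: "summable (\<lambda>p. if 2 \<le> p then (\<beta> p)\<^sup>2 * 1 ^ p else 0)" using assms by (intro xi_summable) auto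
    have le: "norm (if 2 \<le> p then (\<beta> p)\<^sup>2 * t ^ p else 0) \<le> t\<^sup>2 * (if 2 \<le> p then (\<beta> p)\<^sup>2 * 1 ^ p else 0)" for p
    proof (cases "2 \<le> p")
      case True
      have "\<bar>t\<bar> ^ p \<le> \<bar>t\<bar> ^ 2" using True that by (intro power_decreasing) auto
      then have "(\<beta> p)\<^sup>2 * \<bar>t\<bar> ^ p \<le> (\<beta> p)\<^sup>2 * t\<^sup>2" by (intro mult_left_mono) auto
      then show ?thesis using True by (simp add: abs_mult power_abs mult.commute)
    qed simp
    have "norm (xi \<beta> t) \<le> (\<Sum>p. t\<^sup>2 * (if 2 \<le> p then (\<beta> p)\<^sup>2 * 1 ^ p else 0))"
      unfolding xi_def by (rule norm_suminf_le[OF le summable_mult[OF s1]])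
    also have "\<dots> = t\<^sup>2 * xi \<beta> 1" unfolding xi_def using s1 by (rule suminf_mult)
    finally show ?thesis by simp
  qed
  have x0: "xi \<beta> 0 = 0" using bd[of 0] by simp
  show "(xi \<beta> has_real_derivative 0) (at 0)"
    unfolding has_field_derivative_iff
  proof (rule Lim_null_comparison)
    have "\<forall>\<^sub>F t in at (0::real). \<bar>t\<bar> < 1 \<and> t \<noteq> 0"
      by (auto simp: eventually_at intro!: exI[of _ 1])
    then show "\<forall>\<^sub>F t in at 0. norm ((xi \<beta> t - xi \<beta> 0) / (t - 0)) \<le> \<bar>t\<bar> * xi \<beta> 1"
    proof eventually_elim
      case (elim t)
      have "t\<^sup>2 * xi \<beta> 1 = \<bar>t\<bar> * xi \<beta> 1 * \<bar>t\<bar>" by (simp add: power2_eq_square mult_ac)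
      then have "\<bar>xi \<beta> t\<bar> \<le> \<bar>t\<bar> * xi \<beta> 1 * \<bar>t\<bar>" using bd[of t] elim by linarith
      then show ?case using elim by (simp add: x0 abs_divide pos_divide_le_eq)
    qed
    have "((\<lambda>t::real. \<bar>t\<bar> * xi \<beta> 1) \<longlongrightarrow> \<bar>0\<bar> * xi \<beta> 1) (at 0)" by (intro tendsto_intros)
    then show "((\<lambda>t::real. \<bar>t\<bar> * xi \<beta> 1) \<longlongrightarrow> 0) (at 0)" by simp
  qed
qed

text \<open>Bernoulli's inequality is used twice: 1 - t^p is at most p (1 - t), and p is at most (1
  + \<epsilon>)^p / \<epsilon>. The second estimate is paid for by the convergence of the series at
  1 + \<epsilon>, which gives the constant \<open>S / \<epsilon>\<close>.\<close>

lemma xi_increment_bound: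
  assumes "is_model \<beta>"
  obtains L where "L \<ge> 0" "\<And>t. t \<in> {0..1} \<Longrightarrow> xi \<beta> 1 - xi \<beta> t \<le> L * (1 - t)"
proof -
  obtain \<epsilon> where e: "\<epsilon> > 0" "summable (\<lambda>p. if 2 \<le> p then (\<beta> p)\<^sup>2 * (1 + \<epsilon>) ^ p else 0)"
    using assms unfolding is_model_def by auto
  define S where "S = (\<Sum>p. if 2 \<le> p then (\<beta> p)\<^sup>2 * (1 + \<epsilon>) ^ p else 0)"
  have "S \<ge> 0" unfolding S_def using e by (intro suminf_nonneg) auto
  have "xi \<beta> 1 - xi \<beta> t \<le> S / \<epsilon> * (1 - t)" if t: "t \<in> {0..1}" for t
  proof -
    have s: "summable (\<lambda>p. if 2 \<le> p then (\<beta> p)\<^sup>2 * t ^ p else 0)"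
            "summable (\<lambda>p. if 2 \<le> p then (\<beta> p)\<^sup>2 * 1 ^ p else 0)"
      using assms t by (auto intro: xi_summable)
    have "xi \<beta> 1 - xi \<beta> t = (\<Sum>p. (if 2 \<le> p then (\<beta> p)\<^sup>2 * 1 ^ p else 0) - (if 2 \<le> p then (\<beta> p)\<^sup>2 * t ^ p else 0))"
      unfolding xi_def using s by (intro suminf_diff)
    also have "\<dots> \<le> (\<Sum>p. (1 - t) / \<epsilon> * (if 2 \<le> p then (\<beta> p)\<^sup>2 * (1 + \<epsilon>) ^ p else 0))"
    proof (intro suminf_le summable_diff s summable_mult e(2))
      fix p
      have "1 + real p * (t - 1) \<le> (1 + (t - 1)) ^ p" using t by (intro Bernoulli_inequality) auto
      then have "1 - t ^ p \<le> real p * (1 - t)" by (simp add: algebra_simps)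
      moreover have "1 + real p * \<epsilon> \<le> (1 + \<epsilon>) ^ p" using e by (intro Bernoulli_inequality) auto
      then have "real p \<le> (1 + \<epsilon>) ^ p / \<epsilon>" using e by (simp add: pos_le_divide_eq)
      then have "real p * (1 - t) \<le> (1 + \<epsilon>) ^ p / \<epsilon> * (1 - t)" using t by (intro mult_right_mono) auto
      ultimately have "1 - t ^ p \<le> (1 + \<epsilon>) ^ p / \<epsilon> * (1 - t)" by linarith
      then have "(\<beta> p)\<^sup>2 * (1 - t ^ p) \<le> (\<beta> p)\<^sup>2 * ((1 + \<epsilon>) ^ p / \<epsilon> * (1 - t))" by (intro mult_left_mono) auto
      then show "(if 2 \<le> p then (\<beta> p)\<^sup>2 * 1 ^ p else 0) - (if 2 \<le> p then (\<beta> p)\<^sup>2 * t ^ p else 0)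
        \<le> (1 - t) / \<epsilon> * (if 2 \<le> p then (\<beta> p)\<^sup>2 * (1 + \<epsilon>) ^ p else 0)"
        by (simp add: algebra_simps)
    qed
    also have "\<dots> = (1 - t) / \<epsilon> * S" unfolding S_def using e(2) by (rule suminf_mult)
    finally show ?thesis by (simp add: mult_ac)
  qed
  moreover have "S / \<epsilon> \<ge> 0" using e \<open>S \<ge> 0\<close> by simp
  ultimately show ?thesis using that[of "S / \<epsilon>"] by blast
qed

section \<open>Lebesgue decomposition on the real line\<close>

text \<open>Exhaustion: the supremum of \<open>M\<close> over Lebesgue null sets is approached along
  a sequence, and the union \<open>N\<close> of that sequence attains it. A null set with mass
  outside \<open>N\<close> would enlarge \<open>N\<close> beyond the supremum; finiteness of
  \<open>M\<close> allows the cancellation.\<close>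

lemma finite_measure_max_null_set:
  fixes M :: "real measure"
  assumes "finite_measure M" and sM: "sets M = sets borel"
  shows "\<exists>N. N \<in> sets borel \<and> emeasure lborel N = 0 \<and>
    (\<forall>A\<in>sets borel. emeasure lborel A = 0 \<longrightarrow> emeasure M (A - N) = 0)"
proof -
  interpret finite_measure M by fact
  define Z where "Z = null_sets (lborel :: real measure)"
  define s where "s = (SUP A\<in>Z. emeasure M A)"
  have "Z \<noteq> {}" unfolding Z_def by blast
  then obtain g where g: "range g \<subseteq> emeasure M ` Z" "s = (SUP n::nat. g n)"
    using ennreal_SUP_countable_SUP[of Z "emeasure M"] unfolding s_def by auto
  have "\<exists>A\<in>Z. g n = emeasure M A" for n using g(1) by auto
  then obtain F where F: "\<And>n. F n \<in> Z" "\<And>n. g n = emeasure M (F n)" by metis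
  define N where "N = (\<Union>n. F n)"
  have NZ: "N \<in> Z" using F(1) unfolding N_def Z_def by blast
  then have N: "N \<in> sets borel" "emeasure lborel N = 0" by (auto simp: Z_def)
  have "s \<le> emeasure M N" unfolding g(2) F(2)
    by (rule SUP_least, rule emeasure_mono) (use N sM in \<open>auto simp: N_def\<close>)
  have "emeasure M (A - N) = 0" if A: "A \<in> sets borel" "emeasure lborel A = 0" for A
  proof -
    have "A \<in> Z" using A by (auto simp: Z_def null_sets_def)
    then have "N \<union> A \<in> Z" using NZ unfolding Z_def by blast
    then have "emeasure M (N \<union> A) \<le> s" unfolding s_def by (rule SUP_upper)
    then have "emeasure M (N \<union> A) \<le> emeasure M N" using \<open>s \<le> emeasure M N\<close> by simp
    moreover have "emeasure M (N \<union> A) = emeasure M N + emeasure M (A - N)"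
      using plus_emeasure[of N M "A - N"] A N sM by (simp add: Un_Diff_cancel)
    ultimately have "emeasure M N + emeasure M (A - N) \<le> emeasure M N + 0" by simp
    then show ?thesis using emeasure_finite[of N] by (metis ennreal_add_left_cancel_le le_zero_eq infinity_ennreal_def)
  qed
  with N show ?thesis by (intro exI[of _ N]) simp
qed

text \<open>The singular part is \<open>M\<close> restricted to a null set of maximal mass. What
  remains vanishes on every null set, so Radon-Nikodym provides its density.\<close>

lemma lebesgue_decomposition_lborel:
  fixes M :: "real measure"
  assumes "finite_measure M" and sM: "sets M = sets borel"
  shows "\<exists>f \<nu> N. f \<in> borel_measurable borel \<and> (\<forall>x::real. 0 \<le> (f x :: real)) \<and> sets \<nu> = sets borel \<and>
    N \<in> sets borel \<and> emeasure lborel N = 0 \<and> emeasure \<nu> (UNIV - N) = 0 \<and>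
    (\<forall>A\<in>sets borel. emeasure M A = (\<integral>\<^sup>+ x\<in>A. ennreal (f x) \<partial>lborel) + emeasure \<nu> A)"
proof -
  interpret finite_measure M by fact
  have spM: "space M = UNIV" using sets_eq_imp_space_eq[OF sM] by simp
  obtain N where N: "N \<in> sets borel" "emeasure lborel N = 0"
    and NM: "\<And>A. A \<in> sets borel \<Longrightarrow> emeasure lborel A = 0 \<Longrightarrow> emeasure M (A - N) = 0"
    using finite_measure_max_null_set[OF assms] by auto
  define M' where "M' = density M (indicator (UNIV - N))"
  define \<nu> where "\<nu> = density M (indicator N)"
  have sets': "sets M' = sets borel" "sets \<nu> = sets borel" by (auto simp: M'_def \<nu>_def sM)
  have em': "emeasure M' A = emeasure M (A - N)" if "A \<in> sets borel" for A
  proof -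
    have "(UNIV - N) \<inter> A = A - N" by auto
    then show ?thesis using emeasure_restricted[of "UNIV - N" M A] that N sM by (simp add: M'_def)
  qed
  have em\<nu>: "emeasure \<nu> A = emeasure M (A \<inter> N)" if "A \<in> sets borel" for A
    using emeasure_restricted[of N M A] that N sM by (simp add: \<nu>_def Int_commute)
  have "absolutely_continuous lborel M'"
    unfolding absolutely_continuous_def
  proof
    fix A assume "A \<in> null_sets (lborel :: real measure)"
    then have "A \<in> sets borel" "emeasure lborel A = 0" by auto
    then show "A \<in> null_sets M'" using NM em' sets' by (auto simp: null_sets_def)
  qed
  then obtain g where g: "g \<in> borel_measurable lborel" "density lborel g = M'"
    using sigma_finite_measure.Radon_Nikodym[OF sigma_finite_lborel] sets' by (metis sets_lborel)
  have gA: "emeasure M' A = (\<integral>\<^sup>+x. g x * indicator A x \<partial>lborel)" if "A \<in> sets borel" for A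
    unfolding g(2)[symmetric] using g(1) that by (intro emeasure_density) auto
  have "(\<integral>\<^sup>+x. g x \<partial>lborel) = emeasure M (UNIV - N)" using gA[of UNIV] em'[of UNIV] by simp
  then have "(\<integral>\<^sup>+x. g x \<partial>lborel) \<noteq> \<infinity>" using emeasure_finite by simp
  then have fin: "AE x in lborel. g x \<noteq> \<infinity>" using g(1) by (intro nn_integral_PInf_AE) auto
  \<comment> \<open>\<open>enn2real\<close> sends infinity to 0, which changes \<open>g\<close> only
    on a null set because its integral is finite.\<close>
  define f where "f = (\<lambda>x. enn2real (g x))"
  have fA: "(\<integral>\<^sup>+ x\<in>A. ennreal (f x) \<partial>lborel) = emeasure M' A" if "A \<in> sets borel" for A
    unfolding gA[OF that] using fin
    by (intro nn_integral_cong_AE) (auto simp: f_def ennreal_enn2real_if)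
  have dec: "emeasure M A = (\<integral>\<^sup>+ x\<in>A. ennreal (f x) \<partial>lborel) + emeasure \<nu> A" if "A \<in> sets borel" for A
  proof -
    have "emeasure M (A - N) + emeasure M (A \<inter> N) = emeasure M ((A - N) \<union> (A \<inter> N))"
      using that N sM by (intro plus_emeasure) auto
    also have "(A - N) \<union> (A \<inter> N) = A" by auto
    finally show ?thesis using fA em' em\<nu> that by simp
  qed
  have "f \<in> borel_measurable borel" using g(1) by (simp add: f_def)
  moreover have "\<forall>x. 0 \<le> f x" by (simp add: f_def)
  moreover have "(UNIV - N) \<inter> N = {}" by auto
  then have "emeasure \<nu> (UNIV - N) = 0" using em\<nu>[of "UNIV - N"] N by simp
  ultimately show ?thesis
    using dec sets'(2) N by (intro exI[of _ f] exI[of _ \<nu>] exI[of _ N] conjI ballI) simp_all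
qed

text \<open>Fitted to \<open>ac_density\<close>, which prescribes the measure only on intervals with
  both endpoints strictly inside (0, 1). Exhausting half-lines from within extends the agreement to
  a generating family.\<close>

lemma finite_measure_eqI_Ioc:
  fixes M M' :: "real measure"
  assumes sets: "sets M = sets borel" "sets M' = sets borel" and "finite_measure M"
    and out: "emeasure M (UNIV - {0<..<1}) = 0" "emeasure M' (UNIV - {0<..<1}) = 0"
    and Ioc: "\<And>a b. 0 < a \<Longrightarrow> a \<le> b \<Longrightarrow> b < 1 \<Longrightarrow> emeasure M {a<..b} = emeasure M' {a<..b}"
  shows "M = M'"
proof (rule measure_eqI_lessThan[OF sets])
  interpret finite_measure M by fact
  fix x :: real
  show "emeasure M {x<..} < \<infinity>" using emeasure_finite[of "{x<..}"] by (simp add: less_top[symmetric])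
  define A where "A = (\<lambda>n::nat. {max x (1 / Suc n)<..1 - 1 / Suc n})"
  have inc: "incseq A"
  proof (rule incseq_SucI)
    fix n
    have "1 / real (Suc (Suc n)) \<le> 1 / real (Suc n)" by (intro divide_left_mono) auto
    then show "A n \<subseteq> A (Suc n)" unfolding A_def by auto
  qed
  have Un: "(\<Union>n. A n) = {x<..} \<inter> {0<..<1}"
  proof
    show "(\<Union>n. A n) \<subseteq> {x<..} \<inter> {0<..<1}"
    proof
      fix y assume "y \<in> (\<Union>n. A n)"
      then obtain n where n: "y > max x (1 / real (Suc n))" "y \<le> 1 - 1 / real (Suc n)" by (auto simp: A_def)
      moreover have "1 / real (Suc n) > 0" by simp
      ultimately show "y \<in> {x<..} \<inter> {0<..<1}" unfolding greaterThan_iff Int_iff greaterThanLessThan_iff by linarith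
    qed
    show "{x<..} \<inter> {0<..<1} \<subseteq> (\<Union>n. A n)"
    proof
      fix y assume y: "y \<in> {x<..} \<inter> {0<..<1}"
      then have "min y (1 - y) > 0" by auto
      then obtain n where "inverse (real (Suc n)) < min y (1 - y)" using reals_Archimedean by blast
      then have "y \<in> A n" using y by (auto simp: A_def inverse_eq_divide)
      then show "y \<in> (\<Union>n. A n)" by blast
    qed
  qed
  have lim: "(\<lambda>n. emeasure P (A n)) \<longlonglongrightarrow> emeasure P {x<..}"
    if P: "sets P = sets borel" "emeasure P (UNIV - {0<..<1}) = 0" for P
  proof -
    have "(\<lambda>n. emeasure P (A n)) \<longlonglongrightarrow> emeasure P (\<Union>n. A n)"
      using inc by (intro Lim_emeasure_incseq) (auto simp: P A_def)
    moreover have "emeasure P {x<..} = emeasure P ({x<..} \<inter> {0<..<1})"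
    proof (rule emeasure_eq_AE)
      have "AE y in P. y \<in> {0<..<1}"
        by (rule AE_I'[of "UNIV - {0<..<1}"]) (auto simp: P null_sets_def)
      then show "AE y in P. (y \<in> {x<..}) = (y \<in> {x<..} \<inter> {0<..<1})" by eventually_elim auto
    qed (auto simp: P)
    ultimately show ?thesis by (simp add: Un)
  qed
  have "emeasure M (A n) = emeasure M' (A n)" for n
  proof (cases "max x (1 / Suc n) \<le> 1 - 1 / Suc n")
    case True
    moreover have "0 < 1 / real (Suc n)" by simp
    then have "0 < max x (1 / real (Suc n))" "1 - 1 / real (Suc n) < 1" by (simp_all only: less_max_iff_disj) simp_all
    ultimately show ?thesis unfolding A_def by (intro Ioc)
  next
    case False then have "A n = {}" by (auto simp: A_def)
    then show ?thesis by simp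
  qed
  then show "emeasure M {x<..} = emeasure M' {x<..}"
    using lim[OF sets(1) out(1)] lim[OF sets(2) out(2)] LIMSEQ_unique by auto
qed

section \<open>Existence of a density of the second derivative\<close>

text \<open>Ensures that the choice in \<open>D\<close> picks a genuine density: the Stieltjes
  measure of the slopes is decomposed.\<close>

lemma ac_density_exists:
  assumes br: "slope_bracket \<eta> R" 
    and rc: "\<And>x. 0 \<le> x \<Longrightarrow> x < 1 \<Longrightarrow> (R \<longlongrightarrow> R x) (at_right x)"
    and rd: "\<And>x. 0 \<le> x \<Longrightarrow> x < 1 \<Longrightarrow> rderiv \<eta> x = R x"
  shows "\<exists>f. ac_density \<eta> f"
proof -
  \<comment> \<open>Clamping the argument extends \<open>R\<close> by constants to a monotone
    right-continuous function on the whole line.\<close>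
  define F where "F = (\<lambda>x. R (min 1 (max 0 x)))"
  note mono = slope_bracket_mono[OF br]
  have mF: "F x \<le> F y" if "x \<le> y" for x y
    unfolding F_def using that by (intro mono_onD[OF mono]) auto
  have cF: "continuous (at_right x) F" for x
  proof -
    consider "x < 0" | "0 \<le> x" "x < 1" | "1 \<le> x" by linarith
    then have "(F \<longlongrightarrow> F x) (at_right x)"
    proof cases
      case 1
      have "\<forall>\<^sub>F y in at_right x. F x = F y"
        unfolding eventually_at_right_field using 1 by (intro exI[of _ 0]) (auto simp: F_def)
      then show ?thesis by (rule tendsto_eventually[OF eventually_mono]) simp
    next
      case 2
      have "\<forall>\<^sub>F y in at_right x. R y = F y"
        unfolding eventually_at_right_field using 2 by (intro exI[of _ 1]) (auto simp: F_def)
      moreover have "F x = R x" using 2 by (simp add: F_def)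
      ultimately show ?thesis using rc[OF 2] by (simp add: tendsto_cong)
    next
      case 3
      have "\<forall>\<^sub>F y in at_right x. F x = F y"
        unfolding eventually_at_right_field using 3 by (intro exI[of _ "x + 1"]) (auto simp: F_def)
      then show ?thesis by (rule tendsto_eventually[OF eventually_mono]) simp
    qed
    then show ?thesis by (simp add: continuous_within)
  qed
  define I where "I = interval_measure F"
  \<comment> \<open>\<open>F\<close> may jump at 1, since \<open>R 1\<close> is only an upper bound
    for the slopes; restricting to the open interval removes that atom.\<close>
  define M where "M = density I (indicator {0<..<1})"
  have sI: "sets I = sets borel" by (simp add: I_def)
  have eI: "emeasure I {a<..b} = ennreal (F b - F a)" if "a \<le> b" for a b
    unfolding I_def by (rule emeasure_interval_measure_Ioc[OF that mF cF])
  have sM: "sets M = sets borel" by (simp add: M_def I_def)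
  have eM: "emeasure M A = emeasure I (A \<inter> {0<..<1})" if "A \<in> sets borel" for A
    using emeasure_restricted[of "{0<..<1}" I A] that by (simp add: M_def sI Int_commute)
  have "finite_measure M"
  proof
    have "emeasure M UNIV \<le> emeasure I {0<..1}" by (subst eM) (auto simp: sI intro!: emeasure_mono)
    also have "\<dots> < \<infinity>" by (simp add: eI)
    finally show "emeasure M (space M) \<noteq> \<infinity>" by (simp add: M_def I_def)
  qed
  then obtain f \<nu> N where
    f: "f \<in> borel_measurable borel" "\<And>x. 0 \<le> f x" "sets \<nu> = sets borel"
    "N \<in> sets borel" "emeasure lborel N = 0" "emeasure \<nu> (UNIV - N) = 0"
    "\<And>A. A \<in> sets borel \<Longrightarrow> emeasure M A = (\<integral>\<^sup>+ x\<in>A. ennreal (f x) \<partial>lborel) + emeasure \<nu> A"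
    using lebesgue_decomposition_lborel[OF _ sM] by auto
  have "emeasure M {a<..b} = ennreal (rderiv \<eta> b - rderiv \<eta> a)" if "0 < a" "a \<le> b" "b < 1" for a b
  proof -
    have "{a<..b} \<inter> {0<..<1} = {a<..b}" using that by auto
    then show ?thesis using that by (simp add: eM eI rd F_def)
  qed
  moreover have "emeasure M (UNIV - {0<..<1}) = 0"
  proof -
    have "(UNIV - {0<..<1}) \<inter> {0<..<1::real} = {}" by auto
    then show ?thesis by (subst eM) auto
  qed
  ultimately have "ac_density \<eta> f"
    unfolding ac_density_def
    by (intro conjI allI exI[of _ M] exI[of _ \<nu>] exI[of _ N] ballI impI f sM)
  then show ?thesis by (intro exI[of "ac_density \<eta>" f])
qed



section \<open>Feasible densities\<close>

definition cumulative :: "(real \<Rightarrow> real) \<Rightarrow> real \<Rightarrow> ennreal" where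
  "cumulative f s = (\<integral>\<^sup>+ x\<in>{0<..s}. ennreal (f x) \<partial>lborel)"

text \<open>By Tonelli the iterated integral weights f x with 1 - max t x. Working in
  \<open>ennreal\<close> allows Fatou's lemma without prior integrability.\<close>

definition feasible :: "(real \<Rightarrow> real) \<Rightarrow> (real \<Rightarrow> real) \<Rightarrow> bool" where
  "feasible c f \<longleftrightarrow> f \<in> borel_measurable borel \<and> (\<forall>x. 0 \<le> f x) \<and>
     (\<forall>t\<in>{0..<1}. (\<integral>\<^sup>+ s\<in>{t<..<1}. cumulative f s \<partial>lborel) \<le> ennreal (c t))"

lemma cumulative_measurable [measurable]:
  assumes [measurable]: "f \<in> borel_measurable borel"
  shows "cumulative f \<in> borel_measurable borel"
proof -
  have "cumulative f = (\<lambda>s. \<integral>\<^sup>+ x. (if 0 < x \<and> x \<le> s then ennreal (f x) else 0) \<partial>lborel)"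
    unfolding cumulative_def by (intro ext nn_integral_cong) (auto split: split_indicator)
  then show ?thesis by simp
qed

lemma cumulative_mono: "s \<le> t \<Longrightarrow> cumulative f s \<le> cumulative f t"
  unfolding cumulative_def by (intro nn_integral_mono) (auto split: split_indicator)

lemma cumulative_linear:
  assumes [measurable]: "f \<in> borel_measurable borel" "g \<in> borel_measurable borel"
    and nn: "\<And>x. 0 \<le> f x" "\<And>x. 0 \<le> g x" "0 \<le> a" "0 \<le> b"
  shows "cumulative (\<lambda>x. a * f x + b * g x) s = ennreal a * cumulative f s + ennreal b * cumulative g s"
proof -
  have "cumulative (\<lambda>x. a * f x + b * g x) s
    = (\<integral>\<^sup>+ x. ennreal a * (ennreal (f x) * indicator {0<..s} x) + ennreal b * (ennreal (g x) * indicator {0<..s} x) \<partial>lborel)"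
    unfolding cumulative_def using nn
    by (intro nn_integral_cong) (auto simp: ennreal_mult ennreal_plus split: split_indicator)
  also have "\<dots> = ennreal a * cumulative f s + ennreal b * cumulative g s"
    unfolding cumulative_def by (simp add: nn_integral_add nn_integral_cmult)
  finally show ?thesis .
qed

lemma feasible_midpoint:
  assumes f: "feasible c f" and g: "feasible c g"
  shows "feasible c (\<lambda>x. (f x + g x) / 2)"
proof -
  have [measurable]: "f \<in> borel_measurable borel" "g \<in> borel_measurable borel"
    and nn: "\<And>x. 0 \<le> f x" "\<And>x. 0 \<le> g x" using f g by (auto simp: feasible_def)
  have eq: "(\<lambda>x. (f x + g x) / 2) = (\<lambda>x. 1/2 * f x + 1/2 * g x)" by (auto simp: field_simps)
  have "(\<integral>\<^sup>+ s\<in>{t<..<1}. cumulative (\<lambda>x. (f x + g x) / 2) s \<partial>lborel) \<le> ennreal (c t)" if t: "t \<in> {0..<1}" for t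
  proof -
    have "(\<integral>\<^sup>+ s\<in>{t<..<1}. cumulative (\<lambda>x. (f x + g x) / 2) s \<partial>lborel)
      = (\<integral>\<^sup>+ s. ennreal (1/2) * (cumulative f s * indicator {t<..<1} s) + ennreal (1/2) * (cumulative g s * indicator {t<..<1} s) \<partial>lborel)"
      unfolding eq by (intro nn_integral_cong, subst cumulative_linear) (simp_all add: nn algebra_simps)
    also have "\<dots> = ennreal (1/2) * (\<integral>\<^sup>+ s\<in>{t<..<1}. cumulative f s \<partial>lborel)
        + ennreal (1/2) * (\<integral>\<^sup>+ s\<in>{t<..<1}. cumulative g s \<partial>lborel)"
      by (simp add: nn_integral_add nn_integral_cmult)
    also have "\<dots> \<le> ennreal (1/2) * ennreal (c t) + ennreal (1/2) * ennreal (c t)"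
      using f g t by (intro add_mono mult_left_mono) (auto simp: feasible_def)
    also have "\<dots> = ennreal (1/2 + 1/2) * ennreal (c t)"
      by (subst ennreal_plus) (auto simp: distrib_right)
    finally show ?thesis by simp
  qed
  then show ?thesis using nn by (auto simp: feasible_def)
qed

text \<open>Fatou is applied twice, to the inner integral and then to the outer one. Both
  inequalities point the right way because the constraints are upper bounds.\<close>

lemma feasible_AE_limit:
  assumes F: "\<And>n. feasible c (F n)" and [measurable]: "f \<in> borel_measurable borel"
    and nn: "\<And>x. 0 \<le> f x"
    and lim: "AE x in lborel. x \<in> {0<..<1} \<longrightarrow> (\<lambda>n. F n x) \<longlonglongrightarrow> f x"
  shows "feasible c f"
proof -
  have [measurable]: "F n \<in> borel_measurable borel" for n using F by (auto simp: feasible_def)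
  have cum: "cumulative f s \<le> liminf (\<lambda>n. cumulative (F n) s)" if s: "s < 1" for s
  proof -
    have "cumulative f s = (\<integral>\<^sup>+ x. liminf (\<lambda>n. ennreal (F n x) * indicator {0<..s} x) \<partial>lborel)"
      unfolding cumulative_def
    proof (rule nn_integral_cong_AE)
      show "AE x in lborel. ennreal (f x) * indicator {0<..s} x = liminf (\<lambda>n. ennreal (F n x) * indicator {0<..s} x)"
        using lim
      proof eventually_elim
        case (elim x)
        show ?case
        proof (cases "x \<in> {0<..s}")
          case True
          then have "(\<lambda>n. ennreal (F n x)) \<longlonglongrightarrow> ennreal (f x)" using elim s by auto
          then have "liminf (\<lambda>n. ennreal (F n x)) = ennreal (f x)" by (intro lim_imp_Liminf) auto
          then show ?thesis using True by simp
        qed (simp add: Liminf_const)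
      qed
    qed
    also have "\<dots> \<le> liminf (\<lambda>n. cumulative (F n) s)"
      unfolding cumulative_def by (intro nn_integral_liminf) measurable
    finally show ?thesis .
  qed
  have "(\<integral>\<^sup>+ s\<in>{t<..<1}. cumulative f s \<partial>lborel) \<le> ennreal (c t)" if t: "t \<in> {0..<1}" for t
  proof -
    have "(\<integral>\<^sup>+ s\<in>{t<..<1}. cumulative f s \<partial>lborel)
      \<le> (\<integral>\<^sup>+ s. liminf (\<lambda>n. cumulative (F n) s * indicator {t<..<1} s) \<partial>lborel)"
      using cum by (intro nn_integral_mono) (auto split: split_indicator simp: Liminf_const)
    also have "\<dots> \<le> liminf (\<lambda>n. \<integral>\<^sup>+ s\<in>{t<..<1}. cumulative (F n) s \<partial>lborel)"
      by (intro nn_integral_liminf) measurable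
    also have "\<dots> \<le> liminf (\<lambda>n::nat. ennreal (c t))"
      using F t by (intro Liminf_mono) (auto simp: feasible_def)
    also have "\<dots> = ennreal (c t)" by (simp add: Liminf_const)
    finally show ?thesis .
  qed
  then show ?thesis using nn by (auto simp: feasible_def)
qed

text \<open>Since \<open>cumulative f\<close> is nondecreasing, (1 - t) times its value at t is at
  most its integral over (t, 1), hence at most C (1 - t). Dividing by 1 - t gives a bound
  independent of t, and t then tends to 1.\<close>

lemma feasible_integral_bound:
  assumes f: "feasible c f" and c: "\<And>t. t \<in> {0..<1} \<Longrightarrow> c t \<le> C * (1 - t)" and C: "0 \<le> C"
  shows "(\<integral>\<^sup>+ x\<in>{0<..<1}. ennreal (f x) \<partial>lborel) \<le> ennreal C"
proof -
  have [measurable]: "f \<in> borel_measurable borel" using f by (auto simp: feasible_def)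
  have cum: "cumulative f t \<le> ennreal C" if t: "t \<in> {0..<1}" for t
  proof -
    have "ennreal (1 - t) * cumulative f t = (\<integral>\<^sup>+ s\<in>{t<..<1}. cumulative f t \<partial>lborel)"
      using t by (subst nn_integral_cmult_indicator) (auto simp: mult.commute)
    also have "\<dots> \<le> (\<integral>\<^sup>+ s\<in>{t<..<1}. cumulative f s \<partial>lborel)"
      by (intro nn_integral_mono) (auto split: split_indicator intro: cumulative_mono)
    also have "\<dots> \<le> ennreal (c t)" using f t by (auto simp: feasible_def)
    also have "\<dots> \<le> ennreal (C * (1 - t))" using c[OF t] by (rule ennreal_leI)
    also have "\<dots> = ennreal (1 - t) * ennreal C" using C t by (simp add: ennreal_mult mult.commute)
    finally show ?thesis using t by (subst (asm) ennreal_mult_le_mult_iff) auto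
  qed
  define \<mu> where "\<mu> = density lborel (\<lambda>x. ennreal (f x))"
  have em: "emeasure \<mu> A = (\<integral>\<^sup>+ x\<in>A. ennreal (f x) \<partial>lborel)" if "A \<in> sets borel" for A
    unfolding \<mu>_def using that by (intro emeasure_density) auto
  define A where "A = (\<lambda>n::nat. {0<..1 - 1 / real (Suc n)})"
  have "incseq A"
  proof (rule incseq_SucI)
    fix n
    have "1 / real (Suc (Suc n)) \<le> 1 / real (Suc n)" by (intro divide_left_mono) auto
    then show "A n \<subseteq> A (Suc n)" unfolding A_def by auto
  qed
  moreover have "range A \<subseteq> sets \<mu>" by (auto simp: A_def \<mu>_def)
  ultimately have "(\<lambda>n. emeasure \<mu> (A n)) \<longlonglongrightarrow> emeasure \<mu> (\<Union>n. A n)" by (intro Lim_emeasure_incseq)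
  moreover have "(\<Union>n. A n) = {0<..<1}"
  proof
    show "(\<Union>n. A n) \<subseteq> {0<..<1}"
      by (auto simp: A_def) (smt (verit) divide_pos_pos of_nat_0_le_iff)
    show "{0<..<1} \<subseteq> (\<Union>n. A n)"
    proof
      fix y :: real assume y: "y \<in> {0<..<1}"
      then have "0 < 1 - y" by auto
      then obtain n where "inverse (real (Suc n)) < 1 - y" using reals_Archimedean by blast
      then have "y \<in> A n" using y by (auto simp: A_def inverse_eq_divide)
      then show "y \<in> (\<Union>n. A n)" by blast
    qed
  qed
  ultimately have "(\<lambda>n. emeasure \<mu> (A n)) \<longlonglongrightarrow> (\<integral>\<^sup>+ x\<in>{0<..<1}. ennreal (f x) \<partial>lborel)" using em by simp
  then show ?thesis
  proof (rule LIMSEQ_le_const2, intro exI[of _ 0] allI impI)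
    fix n :: nat
    have "1 / real (Suc n) \<le> 1" "0 < 1 / real (Suc n)" by auto
    then have "1 - 1 / real (Suc n) \<in> {0..<1}" unfolding atLeastLessThan_iff by linarith
    then show "emeasure \<mu> (A n) \<le> ennreal C" using em cum by (simp add: A_def cumulative_def)
  qed
qed

lemma feasible_maximizer:
  assumes c0: "\<And>t. t \<in> {0..<1} \<Longrightarrow> 0 \<le> c t"
    and c: "\<And>t. t \<in> {0..<1} \<Longrightarrow> c t \<le> C * (1 - t)" and C: "0 \<le> C"
  defines "J \<equiv> \<lambda>f. \<integral>\<^sup>+ x\<in>{0<..<1::real}. ennreal (sqrt (f x)) \<partial>lborel"
  shows "\<exists>f. feasible c f \<and> (\<forall>g. feasible c g \<longrightarrow> J g \<le> J f \<and>
     (J g = J f \<longrightarrow> (AE x in lborel. x \<in> {0<..<1} \<longrightarrow> g x = f x)))"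
proof -
  define M where "M = restrict_space lborel {0<..<1::real}"
  interpret finite_measure M
    by (rule finite_measureI) (simp add: M_def emeasure_restrict_space space_restrict_space)
  have AE_M: "(AE x in M. P x) \<longleftrightarrow> (AE x in lborel. x \<in> {0<..<1} \<longrightarrow> P x)" for P
    unfolding M_def by (rule AE_restrict_space_iff) simp
  have nn_M: "(\<integral>\<^sup>+x. F x \<partial>M) = (\<integral>\<^sup>+x\<in>{0<..<1}. F x \<partial>lborel)" for F
    unfolding M_def by (rule nn_integral_restrict_space) simp
  have mM: "f \<in> borel_measurable M" if "f \<in> borel_measurable borel" for f :: "real \<Rightarrow> real"
    unfolding M_def using that by (intro measurable_restrict_space1) simp
  have "(\<forall>f\<in>Collect (feasible c). integrable M (\<lambda>x. sqrt (f x))) \<and> (\<exists>f\<in>Collect (feasible c). \<forall>g\<in>Collect (feasible c).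
     (\<integral>x. sqrt (g x) \<partial>M) \<le> (\<integral>x. sqrt (f x) \<partial>M) \<and>
     ((\<integral>x. sqrt (g x) \<partial>M) = (\<integral>x. sqrt (f x) \<partial>M) \<longrightarrow> (AE x in M. g x = f x)))"
  proof (rule integral_sqrt_unique_maximizer[where C = C])
    \<comment> \<open>Nonnegativity of the room \<open>c\<close> makes the zero density
      feasible.\<close>
    have "feasible c (\<lambda>_. 0)" using c0 by (auto simp: feasible_def cumulative_def)
    then show "Collect (feasible c) \<noteq> {}" by auto
    fix f assume f: "f \<in> Collect (feasible c)"
    then show "f \<in> borel_measurable M" by (auto simp: feasible_def intro: mM)
    show "0 \<le> f x" for x using f by (auto simp: feasible_def)
    show "(\<integral>\<^sup>+x. ennreal (f x) \<partial>M) \<le> ennreal C"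
      unfolding nn_M using f feasible_integral_bound[OF _ c C] by simp
    fix g assume "g \<in> Collect (feasible c)"
    then show "(\<lambda>x. (f x + g x) / 2) \<in> Collect (feasible c)" using f feasible_midpoint by simp
  next
    fix F :: "nat \<Rightarrow> real \<Rightarrow> real" and f
    assume F: "\<And>n. F n \<in> Collect (feasible c)" and f: "f \<in> borel_measurable M" "\<And>x. 0 \<le> f x"
      and lim: "AE x in M. (\<lambda>n. F n x) \<longlonglongrightarrow> f x"
    \<comment> \<open>The limit is measurable only on the restricted space; extension by zero gives
      the Borel representative that \<open>feasible\<close> asks for.\<close>
    define f' where "f' = (\<lambda>x. indicator {0<..<1} x *\<^sub>R f x)"
    have "f' \<in> borel_measurable borel"
      using f(1) borel_measurable_restrict_space_iff[of "{0<..<1}" lborel f] by (simp add: f'_def M_def)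
    moreover have "\<And>x. 0 \<le> f' x" using f by (simp add: f'_def)
    moreover have "AE x in lborel. x \<in> {0<..<1} \<longrightarrow> (\<lambda>n. F n x) \<longlonglongrightarrow> f' x"
      using lim unfolding AE_M by eventually_elim (auto simp: f'_def)
    ultimately have "feasible c f'" by (rule feasible_AE_limit[OF F[unfolded mem_Collect_eq]])
    moreover have "AE x in M. f' x = f x" unfolding AE_M by (auto simp: f'_def)
    ultimately show "\<exists>f'\<in>Collect (feasible c). AE x in M. f' x = f x" by auto
  qed
  then obtain f where int: "\<And>f. feasible c f \<Longrightarrow> integrable M (\<lambda>x. sqrt (f x))" and f: "feasible c f"
    and max: "\<And>g. feasible c g \<Longrightarrow> (\<integral>x. sqrt (g x) \<partial>M) \<le> (\<integral>x. sqrt (f x) \<partial>M)"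
    and uniq: "\<And>g. feasible c g \<Longrightarrow> (\<integral>x. sqrt (g x) \<partial>M) = (\<integral>x. sqrt (f x) \<partial>M) \<Longrightarrow> (AE x in M. g x = f x)"
    by auto
  have J: "J g = ennreal (\<integral>x. sqrt (g x) \<partial>M)" if "feasible c g" for g
    unfolding J_def nn_M[symmetric] using that
    by (intro nn_integral_eq_integral int) (auto simp: feasible_def)
  have I0: "0 \<le> (\<integral>x. sqrt (g x) \<partial>M)" if "feasible c g" for g
    using that by (intro integral_nonneg_AE) (auto simp: feasible_def)
  show ?thesis
  proof (intro exI[of _ f] conjI allI impI f)
    fix g assume g: "feasible c g"
    show "J g \<le> J f" unfolding J[OF g] J[OF f] using max[OF g] by (rule ennreal_leI)
    assume "J g = J f"
    then have "(\<integral>x. sqrt (g x) \<partial>M) = (\<integral>x. sqrt (f x) \<partial>M)"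
      unfolding J[OF g] J[OF f] using I0 f g by (subst (asm) ennreal_inj) auto
    then show "AE x in lborel. x \<in> {0<..<1} \<longrightarrow> g x = f x" using uniq[OF g] unfolding AE_M by blast
  qed
qed



section \<open>Densities of the competitors\<close>

text \<open>The bridge between the obstacle and \<open>feasible\<close>: a lower bound on \<eta> at
  t is an upper bound on this integral once the value at 1 and the slope at 0 are fixed.\<close>

lemma slope_bracket_nn_integral:
  assumes br: "slope_bracket \<eta> R" and t: "t \<in> {0..<1}"
  shows "(\<integral>\<^sup>+ s\<in>{t<..<1}. ennreal (R s - R 0) \<partial>lborel) = ennreal (\<eta> 1 - \<eta> t - R 0 * (1 - t))"
proof (rule nn_integral_has_integral_lebesgue')
  note mono = slope_bracket_mono[OF br]
  fix s assume "s \<in> {t<..<1}"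
  then show "0 \<le> R s - R 0" using t mono_onD[OF mono, of 0 s] by auto
next
  note mono = slope_bracket_mono[OF br]
  have "R integrable_on {t..1}" using t by (intro integrable_on_mono_on mono_on_subset[OF mono]) auto
  then have "(R has_integral (\<eta> 1 - \<eta> t)) {t..1}"
    using slope_bracket_increment[OF br, of t 1] t by (simp add: has_integral_iff)
  moreover have "((\<lambda>_. R 0) has_integral (R 0 * (1 - t))) {t..1}"
    using has_integral_const_real[of "R 0" t 1] t by (simp add: mult.commute)
  ultimately have "((\<lambda>s. R s - R 0) has_integral (\<eta> 1 - \<eta> t - R 0 * (1 - t))) {t..1}"
    by (rule has_integral_diff)
  then show "((\<lambda>s. R s - R 0) has_integral (\<eta> 1 - \<eta> t - R 0 * (1 - t))) {t<..<1}"
    by (simp add: has_integral_Icc_iff_Ioo)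
qed

text \<open>Here \<open>e\<close> is the singular mass of (0, s], reduced to what is needed of it
  later: its monotonicity and its sum with \<open>cumulative f\<close>.\<close>

lemma ac_density_cumulative:
  assumes f: "ac_density \<eta> f"
    and rc: "(R \<longlongrightarrow> R 0) (at_right 0)"
    and rd: "\<And>x. 0 \<le> x \<Longrightarrow> x < 1 \<Longrightarrow> rderiv \<eta> x = R x"
  shows "\<exists>e. (\<forall>s\<in>{0<..<1}. cumulative f s + e s = ennreal (R s - R 0)) \<and> (\<forall>s t. s \<le> t \<longrightarrow> e s \<le> e t)"
proof -
  obtain M \<nu> where sM: "sets M = sets borel" and s\<nu>: "sets \<nu> = sets borel"
    and M: "\<And>a b. 0 < a \<Longrightarrow> a \<le> b \<Longrightarrow> b < 1 \<Longrightarrow> emeasure M {a<..b} = ennreal (rderiv \<eta> b - rderiv \<eta> a)"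
    and dec: "\<And>A. A \<in> sets borel \<Longrightarrow> emeasure M A = (\<integral>\<^sup>+ x\<in>A. ennreal (f x) \<partial>lborel) + emeasure \<nu> A"
    using f unfolding ac_density_def by auto
  have lim: "emeasure M {0<..s} = ennreal (R s - R 0)" if s: "s \<in> {0<..<1}" for s
  proof -
    \<comment> \<open>\<open>ac_density\<close> speaks of left endpoints above 0 only, so 0 is
      approached from the right, where right continuity of \<open>R\<close> takes over.\<close>
    define a where "a = (\<lambda>n::nat. s / real (Suc n))"
    have a0: "0 < a n" for n using s by (simp add: a_def)
    have as: "a n \<le> s" for n
      using s divide_left_mono[of 1 "real (Suc n)" s] by (simp add: a_def del: of_nat_Suc)
    have alim: "a \<longlonglongrightarrow> 0" unfolding a_def by (rule LIMSEQ_Suc[OF lim_const_over_n])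
    have "incseq (\<lambda>n. {a n<..s})"
    proof (rule incseq_SucI)
      fix n
      have "a (Suc n) \<le> a n" unfolding a_def using s by (intro divide_left_mono) auto
      then show "{a n<..s} \<subseteq> {a (Suc n)<..s}" by auto
    qed
    then have "(\<lambda>n. emeasure M {a n<..s}) \<longlonglongrightarrow> emeasure M (\<Union>n. {a n<..s})"
      by (intro Lim_emeasure_incseq) (auto simp: sM)
    moreover have "(\<Union>n. {a n<..s}) = {0<..s}"
    proof
      show "(\<Union>n. {a n<..s}) \<subseteq> {0<..s}" using a0 by (auto intro: less_trans[OF a0])
      show "{0<..s} \<subseteq> (\<Union>n. {a n<..s})"
      proof
        fix y assume y: "y \<in> {0<..s}"
        then have "\<forall>\<^sub>F n in sequentially. a n < y" using alim by (auto intro: order_tendstoD(2))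
        then obtain n where "a n < y" by (auto simp: eventually_sequentially)
        then show "y \<in> (\<Union>n. {a n<..s})" using y by auto
      qed
    qed
    moreover have "emeasure M {a n<..s} = ennreal (R s - R (a n))" for n
      using M[OF a0 as, of n] s rd a0[of n] as[of n] by simp
    ultimately have "(\<lambda>n. ennreal (R s - R (a n))) \<longlonglongrightarrow> emeasure M {0<..s}" by simp
    moreover have "filterlim a (at_right 0) sequentially"
      using alim a0 by (intro tendsto_imp_filterlim_at_right) auto
    then have "(\<lambda>n. R (a n)) \<longlonglongrightarrow> R 0" by (rule filterlim_compose[OF rc])
    then have "(\<lambda>n. ennreal (R s - R (a n))) \<longlonglongrightarrow> ennreal (R s - R 0)"
      by (intro tendsto_ennrealI tendsto_diff tendsto_const)
    ultimately show ?thesis by (rule LIMSEQ_unique)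
  qed
  have "\<forall>s\<in>{0<..<1}. cumulative f s + emeasure \<nu> {0<..s} = ennreal (R s - R 0)"
    using lim dec by (auto simp: cumulative_def)
  moreover have "\<forall>s t. s \<le> t \<longrightarrow> emeasure \<nu> {0<..s} \<le> emeasure \<nu> {0<..t}"
    by (auto intro!: emeasure_mono simp: s\<nu>)
  ultimately show ?thesis by (intro exI[of _ "\<lambda>s. emeasure \<nu> {0<..s}"] conjI)
qed

text \<open>The increments of the slope determine the measure, so it equals f dx, and any other
  decomposition must agree with f dx away from the null set that carries its singular part.\<close>

lemma ac_density_AE_unique:
  assumes f': "ac_density \<eta> f'"
    and [measurable]: "f \<in> borel_measurable borel" and nn: "\<And>x. 0 \<le> f x"
    and fin: "(\<integral>\<^sup>+ x\<in>{0<..<1}. ennreal (f x) \<partial>lborel) < \<infinity>"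
    and Ioc: "\<And>a b. 0 < a \<Longrightarrow> a \<le> b \<Longrightarrow> b < 1 \<Longrightarrow>
        (\<integral>\<^sup>+ x\<in>{a<..b}. ennreal (f x) \<partial>lborel) = ennreal (rderiv \<eta> b - rderiv \<eta> a)"
  shows "AE x in lborel. x \<in> {0<..<1} \<longrightarrow> f' x = f x"
proof -
  obtain M \<nu> N where [measurable]: "f' \<in> borel_measurable borel" and nn': "\<And>x. 0 \<le> f' x"
    and sM: "sets M = sets borel" and s\<nu>: "sets \<nu> = sets borel"
    and M: "\<And>a b. 0 < a \<Longrightarrow> a \<le> b \<Longrightarrow> b < 1 \<Longrightarrow> emeasure M {a<..b} = ennreal (rderiv \<eta> b - rderiv \<eta> a)"
    and out: "emeasure M (UNIV - {0<..<1}) = 0"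
    and N[measurable]: "N \<in> sets borel" and N0: "emeasure lborel N = 0" and \<nu>: "emeasure \<nu> (UNIV - N) = 0"
    and dec: "\<And>A. A \<in> sets borel \<Longrightarrow> emeasure M A = (\<integral>\<^sup>+ x\<in>A. ennreal (f' x) \<partial>lborel) + emeasure \<nu> A"
    using f' unfolding ac_density_def by auto
  let ?g = "\<lambda>x. ennreal (f x) * indicator {0<..<1} x" and ?g' = "\<lambda>x. ennreal (f' x) * indicator {0<..<1} x"
  define P where "P = density lborel ?g"
  have sP: "sets P = sets borel" by (simp add: P_def)
  have eP: "emeasure P A = (\<integral>\<^sup>+ x\<in>A. ?g x \<partial>lborel)" if "A \<in> sets borel" for A
    unfolding P_def using that by (intro emeasure_density) auto
  have "finite_measure P"
  proof (rule finite_measureI)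
    have "space P = UNIV" by (simp add: P_def)
    then show "emeasure P (space P) \<noteq> \<infinity>" using fin eP[of UNIV] by simp
  qed
  have "P = M"
  proof (rule finite_measure_eqI_Ioc[OF sP sM \<open>finite_measure P\<close> _ out])
    have "emeasure P (UNIV - {0<..<1}) = (\<integral>\<^sup>+ x. 0 \<partial>(lborel :: real measure))"
      by (subst eP, simp, intro nn_integral_cong) (auto split: split_indicator)
    then show "emeasure P (UNIV - {0<..<1}) = 0" by simp
    fix a b :: real assume ab: "0 < a" "a \<le> b" "b < 1"
    have "emeasure P {a<..b} = (\<integral>\<^sup>+ x\<in>{a<..b}. ennreal (f x) \<partial>lborel)"
      by (subst eP, simp, intro nn_integral_cong) (use ab in \<open>auto split: split_indicator\<close>)
    then show "emeasure P {a<..b} = emeasure M {a<..b}" using Ioc[OF ab] M[OF ab] by simp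
  qed
  have AE_N: "AE x in lborel. x \<notin> N" using N0 N by (intro AE_not_in) (auto simp: null_sets_def)
  have "density lborel ?g' = density lborel ?g"
  proof (rule measure_eqI)
    fix A assume "A \<in> sets (density lborel ?g')"
    then have A[measurable]: "A \<in> sets borel" by simp
    \<comment> \<open>Removing \<open>N\<close> annihilates the singular part and changes no
      Lebesgue integral.\<close>
    define B where "B = A \<inter> {0<..<1} - N"
    have [measurable]: "B \<in> sets borel" by (simp add: B_def)
    have "emeasure \<nu> B \<le> emeasure \<nu> (UNIV - N)" by (intro emeasure_mono) (auto simp: s\<nu> B_def)
    then have \<nu>B: "emeasure \<nu> B = 0" using \<nu> by simp
    have "emeasure (density lborel ?g') A = (\<integral>\<^sup>+ x\<in>A. ?g' x \<partial>lborel)" by (intro emeasure_density) auto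
    also have "\<dots> = (\<integral>\<^sup>+ x\<in>B. ennreal (f' x) \<partial>lborel)"
      using AE_N by (intro nn_integral_cong_AE, eventually_elim) (auto simp: B_def split: split_indicator)
    also have "\<dots> = emeasure M B" using dec[of B] \<nu>B by simp
    also have "\<dots> = (\<integral>\<^sup>+ x\<in>B. ?g x \<partial>lborel)" using eP[of B] \<open>P = M\<close> by simp
    also have "\<dots> = (\<integral>\<^sup>+ x\<in>A. ?g x \<partial>lborel)"
      using AE_N by (intro nn_integral_cong_AE, eventually_elim) (auto simp: B_def split: split_indicator)
    also have "\<dots> = emeasure (density lborel ?g) A" by (intro emeasure_density[symmetric]) auto
    finally show "emeasure (density lborel ?g') A = emeasure (density lborel ?g) A" .
  qed simp
  then have "AE x in lborel. ?g' x = ?g x"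
    by (intro sigma_finite_measure.density_unique[OF sigma_finite_lborel]) auto
  then show ?thesis
  proof eventually_elim
    case (elim x) then show ?case using nn[of x] nn'[of x] by (auto simp: ennreal_inj)
  qed
qed

section \<open>Passing between competitors and feasible densities\<close>

text \<open>The value of \<eta> 1 - \<eta> t - R 0 (1 - t) when \<eta> touches the obstacle at t,
  with the value at 1 and the initial slope of a competitor.\<close>

definition slack :: "(nat \<Rightarrow> real) \<Rightarrow> real \<Rightarrow> real \<Rightarrow> real" where
  "slack \<beta> h t = xi \<beta> 1 - xi \<beta> t + h\<^sup>2 * (1 - t)"

text \<open>The slope bound at 1 comes from the obstacle: \<eta> meets \<xi> at 1 and lies above it
  before, so its increments up to 1 are at most those of \<xi>.\<close>

lemma K_set_slope_bracket:
  assumes "is_model \<beta>" and \<eta>: "\<eta> \<in> K_set h \<beta>"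
  obtains R where "slope_bracket \<eta> R" "R 0 = - h\<^sup>2"
    "\<And>x. 0 \<le> x \<Longrightarrow> x < 1 \<Longrightarrow> (R \<longlongrightarrow> R x) (at_right x)"
    "\<And>x. 0 \<le> x \<Longrightarrow> x < 1 \<Longrightarrow> rderiv \<eta> x = R x"
proof -
  obtain L where L: "L \<ge> 0" "\<And>t. t \<in> {0..1} \<Longrightarrow> xi \<beta> 1 - xi \<beta> t \<le> L * (1 - t)"
    using xi_increment_bound[OF assms(1)] by metis
  have K: "continuous_on {0..1} \<eta>" "convex_on {0..1} \<eta>" "\<And>t. t \<in> {0..1} \<Longrightarrow> xi \<beta> t \<le> \<eta> t" "\<eta> 1 = xi \<beta> 1"
    "(\<eta> has_real_derivative - h\<^sup>2) (at_right 0)"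
    using \<eta> deriv_xi_zero[OF assms(1)] by (auto simp: K_set_def)
  have "\<eta> 1 - \<eta> t \<le> L * (1 - t)" if "t \<in> {0..1}" for t using K(3)[OF that] K(4) L(2)[OF that] by simp
  from convex_imp_slope_bracket[OF K(1,2,5) this] show ?thesis using that by metis
qed

text \<open>The hypothesis is an inequality, so this serves both the density of a competitor with a
  singular part and a density enlarged at the expense of that part.\<close>

lemma feasible_slackI:
  assumes \<eta>: "\<eta> \<in> K_set h \<beta>"
    and br: "slope_bracket \<eta> R" "R 0 = - h\<^sup>2"
    and g: "g \<in> borel_measurable borel" "\<And>x. 0 \<le> g x"
    and le: "\<And>s. s \<in> {0<..<1} \<Longrightarrow> cumulative g s \<le> ennreal (R s - R 0)"
  shows "feasible (slack \<beta> h) g"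
  unfolding feasible_def
proof (intro conjI allI ballI g)
  fix t :: real assume t: "t \<in> {0..<1}"
  have "(\<integral>\<^sup>+ s\<in>{t<..<1}. cumulative g s \<partial>lborel) \<le> (\<integral>\<^sup>+ s\<in>{t<..<1}. ennreal (R s - R 0) \<partial>lborel)"
    using le t by (intro nn_integral_mono) (auto split: split_indicator)
  also have "\<dots> = ennreal (\<eta> 1 - \<eta> t - R 0 * (1 - t))" by (rule slope_bracket_nn_integral[OF br(1) t])
  also have "\<dots> \<le> ennreal (slack \<beta> h t)"
    using \<eta> t by (intro ennreal_leI) (auto simp: K_set_def slack_def br(2))
  finally show "(\<integral>\<^sup>+ s\<in>{t<..<1}. cumulative g s \<partial>lborel) \<le> ennreal (slack \<beta> h t)" .
qed

text \<open>The gain is not computed. The enlarged density dominates \<open>f\<close>, so it is a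
  maximizer too, and uniqueness forces it to equal \<open>f\<close> almost everywhere, although they
  differ by m > 0 on an interval.\<close>

lemma maximal_density_no_excess:
  fixes J :: "(real \<Rightarrow> real) \<Rightarrow> ennreal"
  defines "J \<equiv> \<lambda>f. \<integral>\<^sup>+ x\<in>{0<..<1}. ennreal (sqrt (f x)) \<partial>lborel"
  assumes \<eta>: "\<eta> \<in> K_set h \<beta>" and br: "slope_bracket \<eta> R" "R 0 = - h\<^sup>2"
    and f: "feasible (slack \<beta> h) f"
    and max: "\<And>g. feasible (slack \<beta> h) g \<Longrightarrow> J g \<le> J f"
    and uniq: "\<And>g. feasible (slack \<beta> h) g \<Longrightarrow> J g = J f \<Longrightarrow> AE x in lborel. x \<in> {0<..<1} \<longrightarrow> g x = f x"
    and e: "\<And>s. s \<in> {0<..<1} \<Longrightarrow> cumulative f s + e s = ennreal (R s - R 0)"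
    and mono: "\<And>s t. s \<le> t \<Longrightarrow> e s \<le> e t"
    and x0: "x0 \<in> {0<..<1}"
  shows "e x0 = 0"
proof (rule ccontr)
  assume ne: "e x0 \<noteq> 0"
  have [measurable]: "f \<in> borel_measurable borel" and nn: "\<And>x. 0 \<le> f x" using f by (auto simp: feasible_def)
  have "e x0 \<le> ennreal (R x0 - R 0)" unfolding e[OF x0, symmetric] by (rule add_increasing) auto
  then have "e x0 < top" by (rule le_less_trans) simp
  define m where "m = enn2real (e x0)"
  have em: "ennreal m = e x0" using \<open>e x0 < top\<close> by (simp add: m_def)
  have m: "0 < m" using ne \<open>e x0 < top\<close> by (simp add: m_def enn2real_positive_iff zero_less_iff_neq_zero)
  \<comment> \<open>The mass is put to the right of x0, where \<open>e\<close> is at least m by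
    monotonicity. The interval is shorter than 1, so density m adds at most m to
    \<open>cumulative\<close>.\<close>
  define g where "g = (\<lambda>x. 1 * f x + m * indicator {x0<..<1} x)"
  have [measurable]: "g \<in> borel_measurable borel" by (simp add: g_def)
  have fg: "f x \<le> g x" for x using m by (simp add: g_def)
  have "feasible (slack \<beta> h) g"
  proof (rule feasible_slackI[OF \<eta> br])
    show "0 \<le> g x" for x using fg[of x] nn[of x] by simp
    fix s :: real assume s: "s \<in> {0<..<1}"
    have "cumulative g s = ennreal 1 * cumulative f s + ennreal m * cumulative (indicator {x0<..<1}) s"
      unfolding g_def using nn m by (intro cumulative_linear) auto
    also have "ennreal m * cumulative (indicator {x0<..<1}) s \<le> e s"
    proof (cases "s \<le> x0")
      case True
      have "cumulative (indicator {x0<..<1}) s = (\<integral>\<^sup>+ x. 0 \<partial>(lborel :: real measure))"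
        unfolding cumulative_def using True by (intro nn_integral_cong) (auto split: split_indicator)
      then show ?thesis by simp
    next
      case False
      have "cumulative (indicator {x0<..<1}) s \<le> (\<integral>\<^sup>+ x. indicator {0<..<1::real} x \<partial>lborel)"
        unfolding cumulative_def using x0 by (intro nn_integral_mono) (auto split: split_indicator)
      also have "\<dots> = 1" by simp
      finally have "ennreal m * cumulative (indicator {x0<..<1}) s \<le> ennreal m * 1" by (intro mult_left_mono) auto
      also have "\<dots> \<le> e s" using mono[of x0 s] False em by simp
      finally show ?thesis .
    qed
    finally show "cumulative g s \<le> ennreal (R s - R 0)" using e[OF s] by (simp add: add_left_mono)
  qed measurable
  moreover have "J f \<le> J g"
    unfolding J_def using fg by (intro nn_integral_mono mult_right_mono ennreal_leI real_sqrt_le_mono) auto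
  ultimately have "AE x in lborel. x \<in> {0<..<1} \<longrightarrow> g x = f x"
    using max[of g] by (intro uniq) auto
  then have "AE x in lborel. x \<notin> {x0<..<1}"
  proof eventually_elim
    case (elim x) then show ?case using m x0 by (auto simp: g_def)
  qed
  then have "emeasure lborel {x \<in> space lborel. \<not> x \<notin> {x0<..<1}} = 0"
    by (subst (asm) AE_iff_measurable[OF _ refl]) auto
  moreover have "{x \<in> space lborel. \<not> x \<notin> {x0<..<1}} = {x0<..<1}" by auto
  ultimately have "emeasure lborel {x0<..<1} = 0" by simp
  then show False using x0 by simp
qed

text \<open>Integrates back from the common value at 1. The lemma-internal bound \<open>nn\<close>
  makes \<open>ennreal\<close> injective on the two quantities compared.\<close>

lemma eq_of_same_slopes:
  assumes br: "slope_bracket \<eta> R" and br': "slope_bracket \<eta>' R'" and R0: "R 0 = R' 0" and one: "\<eta> 1 = \<eta>' 1"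
    and R: "\<And>s. s \<in> {0<..<1} \<Longrightarrow> ennreal (R s - R 0) = ennreal (R' s - R' 0)" and t: "t \<in> {0..1}"
  shows "\<eta> t = \<eta>' t"
proof (cases "t = 1")
  case False
  then have t': "t \<in> {0..<1}" using t by auto
  have nn: "0 \<le> \<zeta> 1 - \<zeta> t - S 0 * (1 - t)" if S: "slope_bracket \<zeta> S" for \<zeta> S
  proof -
    have "S 0 * (1 - t) \<le> S t * (1 - t)"
      using t mono_onD[OF slope_bracket_mono[OF S], of 0 t] by (intro mult_right_mono) auto
    then show ?thesis using slope_bracketD(1)[OF S, of t 1] t by simp
  qed
  have "(\<integral>\<^sup>+ s\<in>{t<..<1}. ennreal (R s - R 0) \<partial>lborel) = (\<integral>\<^sup>+ s\<in>{t<..<1}. ennreal (R' s - R' 0) \<partial>lborel)"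
    using R t by (intro nn_integral_cong) (auto split: split_indicator)
  then have "ennreal (\<eta> 1 - \<eta> t - R 0 * (1 - t)) = ennreal (\<eta>' 1 - \<eta>' t - R' 0 * (1 - t))"
    unfolding slope_bracket_nn_integral[OF br t'] slope_bracket_nn_integral[OF br' t'] .
  then have "\<eta> 1 - \<eta> t - R 0 * (1 - t) = \<eta>' 1 - \<eta>' t - R' 0 * (1 - t)"
    using nn[OF br] nn[OF br'] by (subst (asm) ennreal_inj)
  then show ?thesis using R0 one by simp
qed (use one in simp)

text \<open>Integrating f twice gives a competitor without singular part: its slope is an indefinite
  integral, hence continuous, and the feasibility inequality at t is the obstacle condition at
  t.\<close>

lemma feasible_realization:
  assumes model: "is_model \<beta>" and f: "feasible (slack \<beta> h) f"
    and fin: "(\<integral>\<^sup>+ x\<in>{0<..<1}. ennreal (f x) \<partial>lborel) < \<infinity>"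
  shows "\<exists>\<eta> R. \<eta> \<in> K_set h \<beta> \<and> slope_bracket \<eta> R \<and> R 0 = - h\<^sup>2 \<and>
    (\<forall>s\<in>{0<..<1}. cumulative f s = ennreal (R s - R 0)) \<and>
    D \<eta> = 2 * (\<integral>\<^sup>+ x\<in>{0<..<1}. ennreal (sqrt (f x)) \<partial>lborel)"
proof -
  have [measurable]: "f \<in> borel_measurable borel" and nn: "\<And>x. 0 \<le> f x" using f by (auto simp: feasible_def)
  define F where "F = (\<lambda>x. if x \<in> {0<..<1} then f x else 0)"
  have "(\<integral>\<^sup>+ x. ennreal (F x) \<partial>lborel) = (\<integral>\<^sup>+ x\<in>{0<..<1}. ennreal (f x) \<partial>lborel)"
    by (intro nn_integral_cong) (auto simp: F_def split: split_indicator)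
  then have "(\<integral>\<^sup>+ x. ennreal (F x) \<partial>lborel) < top" using fin by simp
  then obtain r where r: "(\<integral>\<^sup>+ x. ennreal (F x) \<partial>lborel) = ennreal r" "0 \<le> r"
    by (metis ennreal_enn2real enn2real_nonneg)
  have "(F has_integral r) UNIV"
    by (rule nn_integral_has_integral[OF _ _ r]) (auto simp: F_def nn)
  then have "(f has_integral r) {0<..<1}" unfolding F_def by (subst (asm) has_integral_restrict_UNIV)
  then have int: "f integrable_on {0..1}" by (auto simp: has_integral_Icc_iff_Ioo[symmetric] integrable_on_def)
  define G where "G = (\<lambda>s. integral {0..s} f)"
  have Gd: "(\<integral>\<^sup>+ x\<in>{a<..b}. ennreal (f x) \<partial>lborel) = ennreal (G b - G a)" and Gm: "G a \<le> G b"
    if ab: "0 \<le> a" "a \<le> b" "b \<le> 1" for a b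
  proof -
    have i: "f integrable_on {a..b}" "f integrable_on {0..b}"
      using ab by (auto intro!: integrable_on_subinterval[OF int])
    have eq: "G b - G a = integral {a..b} f"
      unfolding G_def using Henstock_Kurzweil_Integration.integral_combine[of 0 a b f] ab i by simp
    have "AE x in lborel. x \<noteq> a" by (rule AE_lborel_singleton)
    then have "AE x in lborel. ennreal (f x) * indicator {a<..b} x = ennreal (f x) * indicator {a..b} x"
      by eventually_elim (auto split: split_indicator)
    then have "(\<integral>\<^sup>+ x\<in>{a<..b}. ennreal (f x) \<partial>lborel) = (\<integral>\<^sup>+ x\<in>{a..b}. ennreal (f x) \<partial>lborel)"
      by (rule nn_integral_cong_AE)
    also have "\<dots> = ennreal (integral {a..b} f)"
      using nn i by (intro nn_integral_has_integral_lebesgue' integrable_integral) auto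
    finally show "(\<integral>\<^sup>+ x\<in>{a<..b}. ennreal (f x) \<partial>lborel) = ennreal (G b - G a)" unfolding eq .
    have "0 \<le> integral {a..b} f" using i nn by (intro integral_nonneg) auto
    then show "G a \<le> G b" using eq by simp
  qed
  define R where "R = (\<lambda>s. G s - h\<^sup>2)"
  have G0: "G 0 = 0" by (simp add: G_def)
  have R0: "R 0 = - h\<^sup>2" by (simp add: R_def G0)
  have monoR: "mono_on {0..1} R" by (auto intro!: mono_onI Gm simp: R_def)
  \<comment> \<open>The constant of integration is fixed by the value at 1; the value at 0 is
    whatever results.\<close>
  define k where "k = xi \<beta> 1 - integral {0..1} R"
  define \<eta> where "\<eta> = (\<lambda>t. k + integral {0..t} R)"
  have br: "slope_bracket \<eta> R" unfolding \<eta>_def by (rule slope_bracket_integral[OF monoR])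
  have "continuous_on {0..1} G" unfolding G_def using int by (rule indefinite_integral_continuous_1)
  then have contR: "continuous_on {0..1} R" unfolding R_def by (intro continuous_intros)
  have rc: "(R \<longlongrightarrow> R x) (at_right x)" if x: "0 \<le> x" "x < 1" for x
  proof -
    have "(R \<longlongrightarrow> R x) (at x within {0..1})" using contR x by (auto simp: continuous_on_def)
    then have "(R \<longlongrightarrow> R x) (at x within {x..1})"
      by (rule tendsto_within_subset) (use x in auto)
    then show ?thesis using x by (simp add: at_within_Icc_at_right)
  qed
  have der: "(\<eta> has_real_derivative R x) (at_right x)" if "0 \<le> x" "x < 1" for x
    by (rule slope_bracket_has_right_derivative[OF br that rc[OF that]])
  have rd: "rderiv \<eta> x = R x" if "0 \<le> x" "x < 1" for x
    by (rule rderiv_eqI[OF der[OF that]])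
  have cum: "cumulative f s = ennreal (R s - R 0)" if "s \<in> {0..1}" for s
    using Gd[of 0 s] that by (simp add: cumulative_def R_def G0)
  have one: "\<eta> 1 = xi \<beta> 1" by (simp add: \<eta>_def k_def)
  have ge: "xi \<beta> t \<le> \<eta> t" if t: "t \<in> {0..1}" for t
  proof (cases "t = 1")
    case False
    then have t': "t \<in> {0..<1}" using t by auto
    have "ennreal (\<eta> 1 - \<eta> t - R 0 * (1 - t)) = (\<integral>\<^sup>+ s\<in>{t<..<1}. ennreal (R s - R 0) \<partial>lborel)"
      by (rule slope_bracket_nn_integral[OF br t', symmetric])
    also have "\<dots> = (\<integral>\<^sup>+ s\<in>{t<..<1}. cumulative f s \<partial>lborel)"
      using t cum by (intro nn_integral_cong) (auto split: split_indicator)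
    also have "\<dots> \<le> ennreal (slack \<beta> h t)" using f t' by (auto simp: feasible_def)
    finally have "\<eta> 1 - \<eta> t - R 0 * (1 - t) \<le> slack \<beta> h t"
      using xi_le_xi_one[OF model t] t by (subst (asm) ennreal_le_iff) (auto simp: slack_def)
    then show ?thesis by (simp add: slack_def R0 one)
  qed (simp add: one)
  have K: "\<eta> \<in> K_set h \<beta>"
    unfolding K_set_def
    using slope_bracket_continuous[OF br] slope_bracket_convex[OF br] ge one der[of 0] R0 deriv_xi_zero[OF model]
    by simp
  \<comment> \<open>The density chosen inside \<open>D\<close> need not be \<open>f\<close> itself;
    it agrees with \<open>f\<close> almost everywhere on (0, 1), which is enough for the integral of
    the root.\<close>
  define f' where "f' = (SOME f. ac_density \<eta> f)"
  have "ac_density \<eta> f'" unfolding f'_def by (rule someI_ex[OF ac_density_exists[OF br rc rd]])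
  then have "AE x in lborel. x \<in> {0<..<1} \<longrightarrow> f' x = f x"
  proof (rule ac_density_AE_unique[OF _ _ nn fin])
    fix a b :: real assume ab: "0 < a" "a \<le> b" "b < 1"
    then show "(\<integral>\<^sup>+ x\<in>{a<..b}. ennreal (f x) \<partial>lborel) = ennreal (rderiv \<eta> b - rderiv \<eta> a)"
      using Gd[of a b] rd by (simp add: R_def)
  qed measurable
  then have "(\<integral>\<^sup>+ x\<in>{0<..<1}. ennreal (sqrt (f' x)) \<partial>lborel) = (\<integral>\<^sup>+ x\<in>{0<..<1}. ennreal (sqrt (f x)) \<partial>lborel)"
    by (intro nn_integral_cong_AE, eventually_elim) (auto split: split_indicator)
  then have "D \<eta> = 2 * (\<integral>\<^sup>+ x\<in>{0<..<1}. ennreal (sqrt (f x)) \<partial>lborel)" unfolding D_def f'_def by simp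
  then show ?thesis using K br R0 cum by (intro exI[of _ \<eta>] exI[of _ R] conjI ballI) auto
qed

theorem theorem3p6:
  fixes \<beta> :: "nat \<Rightarrow> real" and h :: real
  assumes "is_model \<beta>" and "0 \<le> h"
  shows "\<exists>\<eta>\<in>K_set h \<beta>. (\<forall>\<eta>'\<in>K_set h \<beta>. D \<eta>' \<le> D \<eta>) \<and>
           (\<forall>\<eta>'\<in>K_set h \<beta>. D \<eta>' = D \<eta> \<longrightarrow> (\<forall>t\<in>{0..1}. \<eta>' t = \<eta> t))"
proof -
  define J where "J = (\<lambda>f. \<integral>\<^sup>+ x\<in>{0<..<1::real}. ennreal (sqrt (f x)) \<partial>lborel)"
  let ?c = "slack \<beta> h"
  obtain L where L: "L \<ge> 0" "\<And>t. t \<in> {0..1} \<Longrightarrow> xi \<beta> 1 - xi \<beta> t \<le> L * (1 - t)"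
    using xi_increment_bound[OF assms(1)] by metis
  have c0: "0 \<le> ?c t" if "t \<in> {0..<1}" for t
    using xi_le_xi_one[OF assms(1), of t] that by (simp add: slack_def)
  \<comment> \<open>The Lipschitz constant of \<xi> at 1 and the initial slope together bound the
    room linearly in 1 - t, the form required for the L1 bound.\<close>
  have cC: "?c t \<le> (L + h\<^sup>2) * (1 - t)" if "t \<in> {0..<1}" for t
    using L(2)[of t] that by (simp add: slack_def distrib_right)
  have C: "0 \<le> L + h\<^sup>2" using L by simp
  obtain f where f: "feasible ?c f" and max: "\<And>g. feasible ?c g \<Longrightarrow> J g \<le> J f"
    and uniq: "\<And>g. feasible ?c g \<Longrightarrow> J g = J f \<Longrightarrow> AE x in lborel. x \<in> {0<..<1} \<longrightarrow> g x = f x"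
    using feasible_maximizer[of ?c, OF c0 cC C] unfolding J_def by auto
  have "(\<integral>\<^sup>+ x\<in>{0<..<1}. ennreal (f x) \<partial>lborel) < \<infinity>"
    using feasible_integral_bound[OF f cC C] by (simp add: le_less_trans[OF _ ennreal_less_top])
  from feasible_realization[OF assms(1) f this] obtain \<eta> R where \<eta>: "\<eta> \<in> K_set h \<beta>"
    and R: "slope_bracket \<eta> R" "R 0 = - h\<^sup>2" "\<And>s. s \<in> {0<..<1} \<Longrightarrow> cumulative f s = ennreal (R s - R 0)"
    and D: "D \<eta> = 2 * J f" unfolding J_def by auto
  have main: "D \<eta>' \<le> D \<eta> \<and> (D \<eta>' = D \<eta> \<longrightarrow> (\<forall>t\<in>{0..1}. \<eta>' t = \<eta> t))" if \<eta>': "\<eta>' \<in> K_set h \<beta>" for \<eta>'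
  proof -
    obtain R' where R': "slope_bracket \<eta>' R'" "R' 0 = - h\<^sup>2"
      and rc: "\<And>x. 0 \<le> x \<Longrightarrow> x < 1 \<Longrightarrow> (R' \<longlongrightarrow> R' x) (at_right x)"
      and rd: "\<And>x. 0 \<le> x \<Longrightarrow> x < 1 \<Longrightarrow> rderiv \<eta>' x = R' x"
      using K_set_slope_bracket[OF assms(1) \<eta>'] by metis
    define f' where "f' = (SOME f. ac_density \<eta>' f)"
    have ac: "ac_density \<eta>' f'" unfolding f'_def by (rule someI_ex[OF ac_density_exists[OF R'(1) rc rd]])
    have D': "D \<eta>' = 2 * J f'" unfolding D_def J_def f'_def ..
    have "\<exists>e. (\<forall>s\<in>{0<..<1}. cumulative f' s + e s = ennreal (R' s - R' 0)) \<and> (\<forall>s t. s \<le> t \<longrightarrow> e s \<le> e t)"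
      by (rule ac_density_cumulative[OF ac rc rd]) auto
    then obtain e where e: "\<And>s. s \<in> {0<..<1} \<Longrightarrow> cumulative f' s + e s = ennreal (R' s - R' 0)"
      and mono: "\<And>s t. s \<le> t \<Longrightarrow> e s \<le> e t" by metis
    have f': "feasible ?c f'"
    proof (rule feasible_slackI[OF \<eta>' R'])
      show "f' \<in> borel_measurable borel" "0 \<le> f' x" for x using ac by (auto simp: ac_density_def)
      show "cumulative f' s \<le> ennreal (R' s - R' 0)" if "s \<in> {0<..<1}" for s
        unfolding e[OF that, symmetric] by simp
    qed
    have "\<eta>' t = \<eta> t" if eq: "D \<eta>' = D \<eta>" and t: "t \<in> {0..1}" for t
    proof (rule eq_of_same_slopes[OF R'(1) R(1) _ _ _ t])
      have Jeq: "J f' = J f" using eq unfolding D D' by (subst (asm) ennreal_mult_cancel_left) simp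
      have AE_eq: "AE x in lborel. x \<in> {0<..<1} \<longrightarrow> f' x = f x" by (rule uniq[OF f' Jeq])
      fix s :: real assume s: "s \<in> {0<..<1}"
      have "e s = 0"
      \<comment> \<open>Applied to the competitor with its own density f', which inherits maximality
        and uniqueness from \<open>f\<close> because the values of \<open>J\<close> agree and f' = f
        almost everywhere.\<close>
      proof (rule maximal_density_no_excess[OF \<eta>' R' f' _ _ e mono s])
        fix g assume g: "feasible ?c g"
        show "(\<integral>\<^sup>+ x\<in>{0<..<1}. ennreal (sqrt (g x)) \<partial>lborel) \<le> (\<integral>\<^sup>+ x\<in>{0<..<1}. ennreal (sqrt (f' x)) \<partial>lborel)"
          using max[OF g] Jeq unfolding J_def by simp
        assume "(\<integral>\<^sup>+ x\<in>{0<..<1}. ennreal (sqrt (g x)) \<partial>lborel) = (\<integral>\<^sup>+ x\<in>{0<..<1}. ennreal (sqrt (f' x)) \<partial>lborel)"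
        then have "J g = J f" using Jeq unfolding J_def by simp
        from uniq[OF g this] AE_eq show "AE x in lborel. x \<in> {0<..<1} \<longrightarrow> g x = f' x"
          by eventually_elim auto
      qed
      then have "ennreal (R' s - R' 0) = cumulative f' s" using e[OF s] by simp
      also have "\<dots> = cumulative f s"
        unfolding cumulative_def using AE_eq
        by (intro nn_integral_cong_AE, eventually_elim) (use s in \<open>auto split: split_indicator\<close>)
      finally show "ennreal (R' s - R' 0) = ennreal (R s - R 0)" using R(3)[OF s] by simp
    qed (use R R' \<eta> \<eta>' in \<open>auto simp: K_set_def\<close>)
    then show ?thesis unfolding D D' using max[OF f'] by (auto intro: mult_left_mono)
  qed
  then show ?thesis using \<eta> by (intro bexI[of _ \<eta>]) auto
qed

end
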